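(* Algorithm 3 (described in the context) is a 4-approximation algorithm for the Non-Linear UFP-Cover problem (UFP-Cover with non-linear costs) in the list model: it outputs a feasible solution whose cost is at most 4 times the minimum cost of a feasible solution.
   Context: Non-Linear UFP-Cover problem: given $I=\{1,\dots,k\}$, a finite set $N$ of items, for each $i\in N$ a sub-interval $I_i\subseteq I$ and a non-decreasing $f_i:\{0,\dots,m\}\to\mathbb{Q}_{\ge0}\cup\{\infty\}$, and demands $D_t\in\mathbb{N}$, $t\in I$; choose $x\in\{0,\dots,m\}^N$ with $\sum_{i:t\in I_i}x_i\ge D_t$ for all $t$ minimizing $\sum_if_i(x_i)$. The instance is assumed feasible; in the list model all values $f_i(0),\dots,f_i(m)$ are given. $M=\{1,\dots,m\}$, $g_{ij}=f_i(j)-f_i(j-1)$; $z_{ij}=1$ iff $x_i\ge j$. For $a\in\{0,\dots,m\}^N$, $t\in I$: $D_t(a)=\max\{D_t-\sum_{i:t\in I_i}a_i,0\}$, $m_i^t(a)=\min\{m,a_i+D_t(a)\}$. $\mathcal H$: triples $(t,a,F)$ with $t\in I$, $a\in\{0,\dots,m\}^N$, $F=(F_i^k)_{i\in N,0\le k\le m-1}$ with $F_i^0,\dots,F_i^{m-1}$ pairwise disjoint with union $\{a_i+1,\dots,m\}$ and $j\in F_i^k\Rightarrow j-k\ge1$. $\tau(i,j,a,F,t)=|\{\ell\ge j:\ell\in F_i^{\ell-j},\ \ell\le m_i^t(a)\}|$. Dual LP [D-UFP]: maximize $\sum_{(t,a,F)\in\mathcal H}D_t(a)v_{atF}$ s.t.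 $\sum_{(t,a,F)\in\mathcal H:\,t\in I_i,\,a_i<j}\tau(i,j,a,F,t)v_{atF}\le g_{ij}$ for all $i,j$, $v\ge0$. Algorithm 3. Call $(i,j)$ full when its dual constraint is tight. Initialize $v=0$, $z=0$, $a=0$, $F_i^0=M$, $F_i^k=\emptyset$ ($k\ge1$), $\mathcal B_i=\emptyset$. Growing phase: while some $D_t(a)>0$: select $t$ maximizing $D_t(a)$ (ties arbitrary); continuously increase $v_{atF}$ until some dual constraint $(i,j)$ becomes tight, ties broken in favor of smallest $j$. If $j>a_i+1$: let $p<j$ be maximal with $(i,p)$ not full, $q>j$ minimal with $(i,q)$ not full ($q=m+1$ if none); for $\ell=j,\dots,q-1$ move $\ell$ from $F_i^{\ell-j}$ to $F_i^{\ell-p}$. Otherwise: let $q>a_i$ be maximal such that $j'\notin F_i^0$ for all $j'=j+1,\dots,q$; set $a_i\leftarrow q$ and add block $b_{ij}=\{j,\dots,q\}$ to $\mathcal B_i$. Pruning phase: for each block $b_{ij}$ in reverse order of creation, if removing it (decreasing $x_i$ by $|b_{ij}|$) keeps all demands satisfied and $j\ge j'$ for all $b_{ij'}\in\mathcal B_i$, remove it. Output $z$ with $z_{ij}=1$ iff $j\le\sum_{b\in\mathcal B_i}|b|$, i.e. $x_i=\sum_{b\in\mathcal B_i}|b|$. *)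

theory Defs
  imports "HOL-Library.Extended_Real" "HOL-Library.FuncSet" "HOL-Library.Disjoint_Sets"
begin

record 'a ufp =
  len :: nat                            \<comment> \<open>k\<close>
  mx :: nat                             \<comment> \<open>m\<close>
  items :: "'a set"                     \<comment> \<open>N\<close>
  ival :: "'a \<Rightarrow> nat set"               \<comment> \<open>the sub-interval of item i\<close>
  fcost :: "'a \<Rightarrow> nat \<Rightarrow> ereal"         \<comment> \<open>f\<close>
  dem :: "nat \<Rightarrow> nat"                   \<comment> \<open>D\<close>

definition ufp_instance :: "'a ufp \<Rightarrow> bool" where
  "ufp_instance P \<longleftrightarrow>
     finite (items P) \<and>
     (\<forall>i\<in>items P. (\<exists>l r. ival P i = {l..r}) \<and> ival P i \<subseteq> {1..len P}) \<and>
     (\<forall>i\<in>items P. \<forall>j\<in>{0..mx P}.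
        fcost P i j = \<infinity> \<or> (\<exists>c\<in>\<rat>. 0 \<le> c \<and> fcost P i j = ereal c)) \<and>
     (\<forall>i\<in>items P. mono_on {0..mx P} (fcost P i))"

definition covers :: "'a ufp \<Rightarrow> ('a \<Rightarrow> nat) \<Rightarrow> bool" where
  "covers P x \<longleftrightarrow> (\<forall>t\<in>{1..len P}. dem P t \<le> (\<Sum>i\<in>{i\<in>items P. t \<in> ival P i}. x i))"

definition feasible :: "'a ufp \<Rightarrow> ('a \<Rightarrow> nat) set" where
  "feasible P = {x \<in> items P \<rightarrow>\<^sub>E {0..mx P}. covers P x}"

definition cost :: "'a ufp \<Rightarrow> ('a \<Rightarrow> nat) \<Rightarrow> ereal" where
  "cost P x = (\<Sum>i\<in>items P. fcost P i (x i))"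

definition opt :: "'a ufp \<Rightarrow> ereal" where
  "opt P = Min (cost P ` feasible P)"

text \<open>On extended reals \<open>\<infinity> - \<infinity> = \<infinity>\<close>, so \<open>gcost P i j = \<infinity>\<close> whenever \<open>fcost P i j = \<infinity>\<close>.\<close>

definition gcost :: "'a ufp \<Rightarrow> 'a \<Rightarrow> nat \<Rightarrow> ereal" where
  "gcost P i j = fcost P i j - fcost P i (j - 1)"

text \<open>Truncated subtraction provides the maximum with 0.\<close>

definition resid :: "'a ufp \<Rightarrow> ('a \<Rightarrow> nat) \<Rightarrow> nat \<Rightarrow> nat" where
  "resid P a t = dem P t - (\<Sum>i\<in>{i\<in>items P. t \<in> ival P i}. a i)"

definition mcap :: "'a ufp \<Rightarrow> ('a \<Rightarrow> nat) \<Rightarrow> nat \<Rightarrow> 'a \<Rightarrow> nat" where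
  "mcap P a t i = min (mx P) (a i + resid P a t)"

type_synonym 'a classes = "'a \<Rightarrow> nat \<Rightarrow> nat set"   \<comment> \<open>\<open>F i k\<close> is \<open>F\<^sub>i\<^sup>k\<close>\<close>
type_synonym 'a triple = "nat \<times> ('a \<Rightarrow> nat) \<times> 'a classes"

text \<open>Vectors and families are extensional functions, which makes this index set finite.\<close>

definition Hset :: "'a ufp \<Rightarrow> 'a triple set" where
  "Hset P = {(t, a, F).
     t \<in> {1..len P} \<and>
     a \<in> items P \<rightarrow>\<^sub>E {0..mx P} \<and>
     F \<in> items P \<rightarrow>\<^sub>E ({..<mx P} \<rightarrow>\<^sub>E UNIV) \<and>
     (\<forall>i\<in>items P.
        disjoint_family_on (F i) {..<mx P} \<and>
        (\<Union>k<mx P. F i k) = {a i + 1..mx P} \<and>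
        (\<forall>k<mx P. \<forall>j\<in>F i k. k + 1 \<le> j))}"

definition tau :: "'a ufp \<Rightarrow> 'a \<Rightarrow> nat \<Rightarrow> ('a \<Rightarrow> nat) \<Rightarrow> 'a classes \<Rightarrow> nat \<Rightarrow> nat" where
  "tau P i j a F t = card {l. j \<le> l \<and> l \<in> F i (l - j) \<and> l \<le> mcap P a t i}"

definition dual_lhs :: "'a ufp \<Rightarrow> ('a triple \<Rightarrow> real) \<Rightarrow> 'a \<Rightarrow> nat \<Rightarrow> real" where
  "dual_lhs P v i j =
     (\<Sum>(t, a, F)\<in>{(t, a, F). (t, a, F) \<in> Hset P \<and> t \<in> ival P i \<and> a i < j}.
        real (tau P i j a F t) * v (t, a, F))"

definition dual_feasible :: "'a ufp \<Rightarrow> ('a triple \<Rightarrow> real) \<Rightarrow> bool" where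
  "dual_feasible P v \<longleftrightarrow>
     (\<forall>h\<in>Hset P. 0 \<le> v h) \<and>
     (\<forall>i\<in>items P. \<forall>j\<in>{1..mx P}. ereal (dual_lhs P v i j) \<le> gcost P i j)"

definition full :: "'a ufp \<Rightarrow> ('a triple \<Rightarrow> real) \<Rightarrow> 'a \<Rightarrow> nat \<Rightarrow> bool" where
  "full P v i j \<longleftrightarrow> ereal (dual_lhs P v i j) = gcost P i j"

text \<open>
  The constraints that can stop the increase of \<open>v (t, a, F)\<close>: tight, and with a positive
  coefficient for this variable. A constraint that was tight before the increase and does not
  involve the variable is not a candidate; one that was left over from an earlier tie and does
  involve it stops the increase at once (an increase by 0).
\<close>

definition stops :: "'a ufp \<Rightarrow> ('a triple \<Rightarrow> real) \<Rightarrow> 'a triple \<Rightarrow> 'a \<Rightarrow> nat \<Rightarrow> bool" where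
  "stops P v h i j \<longleftrightarrow> (case h of (t, a, F) \<Rightarrow>
     i \<in> items P \<and> j \<in> {1..mx P} \<and> full P v i j \<and>
     t \<in> ival P i \<and> a i < j \<and> 0 < tau P i j a F t)"

text \<open>
  Moves every \<open>l \<in> {j..<q}\<close> from \<open>F i (l - j)\<close> to \<open>F i (l - p)\<close>; an \<open>l\<close> that is not in
  \<open>F i (l - j)\<close> stays where it is.
\<close>

definition move :: "'a ufp \<Rightarrow> 'a classes \<Rightarrow> 'a \<Rightarrow> nat \<Rightarrow> nat \<Rightarrow> nat \<Rightarrow> 'a classes" where
  "move P F i j p q = F(i := \<lambda>k\<in>{..<mx P}.
     (F i k - {l \<in> {j..<q}. k = l - j}) \<union>
     {l \<in> {j..<q}. k = l - p \<and> l \<in> F i (l - j)})"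

text \<open>
  Once \<open>a i\<close> has been raised to \<open>q\<close>, the elements up to \<open>q\<close> are deleted from the classes of
  \<open>i\<close>, so that they partition \<open>{a i + 1..mx P}\<close> again, as membership in \<^const>\<open>Hset\<close> requires.
  The coefficients \<^const>\<open>tau\<close> of the constraints with \<open>a i < j\<close> do not depend on those elements.
\<close>

definition drop_upto :: "'a ufp \<Rightarrow> 'a classes \<Rightarrow> 'a \<Rightarrow> nat \<Rightarrow> 'a classes" where
  "drop_upto P F i q = F(i := \<lambda>k\<in>{..<mx P}. F i k - {..q})"

type_synonym 'a block = "'a \<times> nat \<times> nat set"   \<comment> \<open>\<open>(i, j, b)\<close> with \<open>b = b\<^sub>i\<^sub>j\<close>\<close>

record 'a state =
  dual :: "'a triple \<Rightarrow> real"
  lev :: "'a \<Rightarrow> nat"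
  cls :: "'a classes"
  blocks :: "'a block list"             \<comment> \<open>most recently created block first\<close>

definition init :: "'a ufp \<Rightarrow> 'a state" where
  "init P = \<lparr>dual = (\<lambda>_. 0),
             lev = (\<lambda>i\<in>items P. 0),
             cls = (\<lambda>i\<in>items P. \<lambda>k\<in>{..<mx P}. if k = 0 then {1..mx P} else {}),
             blocks = []\<rparr>"

definition finished :: "'a ufp \<Rightarrow> 'a state \<Rightarrow> bool" where
  "finished P s \<longleftrightarrow> \<not> (\<exists>t\<in>{1..len P}. 0 < resid P (lev s) t)"

text \<open>
  \<open>raise P s t v' i j\<close>: time \<open>t\<close> is selected, the variable of \<open>t\<close> and the current \<open>a\<close>, \<open>F\<close> is
  increased as far as dual feasibility permits, which yields \<open>v'\<close>, and \<open>(i, j)\<close> is a constraint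
  that stops the increase, with smallest \<open>j\<close>.
\<close>

definition raise ::
  "'a ufp \<Rightarrow> 'a state \<Rightarrow> nat \<Rightarrow> ('a triple \<Rightarrow> real) \<Rightarrow> 'a \<Rightarrow> nat \<Rightarrow> bool" where
  "raise P s t v' i j \<longleftrightarrow>
     t \<in> {1..len P} \<and> 0 < resid P (lev s) t \<and>
     (\<forall>t'\<in>{1..len P}. resid P (lev s) t' \<le> resid P (lev s) t) \<and>
     (let h = (t, lev s, cls s) in
        (\<exists>d\<ge>0. v' = (dual s)(h := dual s h + d)) \<and>
        dual_feasible P v' \<and>
        stops P v' h i j \<and>
        (\<forall>i' j'. stops P v' h i' j' \<longrightarrow> j \<le> j'))"

inductive grow :: "'a ufp \<Rightarrow> 'a state \<Rightarrow> 'a state \<Rightarrow> bool" for P where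
  regroup:
    "raise P s t v i j \<Longrightarrow> j > lev s i + 1 \<Longrightarrow>
     1 \<le> p \<Longrightarrow> p < j \<Longrightarrow> \<not> full P v i p \<Longrightarrow> (\<forall>r. p < r \<and> r < j \<longrightarrow> full P v i r) \<Longrightarrow>
     j < q \<Longrightarrow> q \<le> mx P + 1 \<Longrightarrow> q = mx P + 1 \<or> \<not> full P v i q \<Longrightarrow>
     (\<forall>r. j < r \<and> r < q \<longrightarrow> full P v i r) \<Longrightarrow>
     grow P s (s\<lparr>dual := v, cls := move P (cls s) i j p q\<rparr>)"
| new_block:
    "raise P s t v i j \<Longrightarrow> \<not> j > lev s i + 1 \<Longrightarrow>
     q = Max {q. lev s i < q \<and> q \<le> mx P \<and> (\<forall>j'\<in>{j+1..q}. j' \<notin> cls s i 0)} \<Longrightarrow>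
     grow P s (s\<lparr>dual := v,
                 lev := (lev s)(i := q),
                 cls := drop_upto P (cls s) i q,
                 blocks := (i, j, {j..q}) # blocks s\<rparr>)"

definition sol :: "'a ufp \<Rightarrow> 'a block set \<Rightarrow> 'a \<Rightarrow> nat" where
  "sol P B = (\<lambda>i\<in>items P. \<Sum>(i', j, b)\<in>{(i', j, b). (i', j, b) \<in> B \<and> i' = i}. card b)"

definition prune_block :: "'a ufp \<Rightarrow> 'a block \<Rightarrow> 'a block set \<Rightarrow> 'a block set" where
  "prune_block P = (\<lambda>(i, j, b) B.
     if covers P ((sol P B)(i := sol P B i - card b)) \<and>
        (\<forall>(i', j', b')\<in>B. i' = i \<longrightarrow> j' \<le> j)
     then B - {(i, j, b)} else B)"

definition prune :: "'a ufp \<Rightarrow> 'a block list \<Rightarrow> 'a block set" where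
  "prune P bs = fold (prune_block P) bs (set bs)"

text \<open>
  \<open>alg3_output P x\<close>: some run of the algorithm, for some way of breaking the ties it leaves
  open, outputs \<open>x\<close>.
\<close>

definition alg3_output :: "'a ufp \<Rightarrow> ('a \<Rightarrow> nat) \<Rightarrow> bool" where
  "alg3_output P x \<longleftrightarrow>
     (\<exists>s. (grow P)\<^sup>*\<^sup>* (init P) s \<and> finished P s \<and> x = sol P (prune P (blocks s)))"

end

theory Submission imports Defs begin

text \<open>
  Call the elements of \<open>F\<^sub>i\<^sup>0\<close> the roots of item \<open>i\<close>. The classes encode a partition of
  \<open>{a\<^sub>i + 1..m}\<close> into intervals, each starting at a root, where \<open>l \<in> F\<^sub>i\<^sup>k\<close> says that the interval
  of \<open>l\<close> starts at \<open>l - k\<close>. Every growing step deletes exactly one root (it merges an interval with its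
  predecessor, or turns the first interval into a block), which bounds the number of steps, and
  every pair that is not a root is full.

  Since intervals are only ever merged, the output level \<open>x\<^sub>i\<close>, if it exceeds \<open>a\<^sub>i\<close>, is the end of an
  interval of every earlier family \<open>F\<close>. Hence the coefficients of \<open>v (t, a, F)\<close> in the
  constraints paid for by \<open>x\<close> add up to the sum of \<open>min (x\<^sub>i - a\<^sub>i) D\<^sub>t(a)\<close> over the items with
  \<open>t \<in> I\<^sub>i\<close>, whereas for an arbitrary feasible solution they add up to at least \<open>D\<^sub>t(a)\<close>. It remains to bound
  that sum by \<open>4 D\<^sub>t(a)\<close>. If \<open>x\<^sub>i > a\<^sub>i\<close>, reverse deletion kept the topmost block of \<open>i\<close> because of
  some time \<open>p\<^sub>i \<in> I\<^sub>i\<close>, at which the other items exceed \<open>a\<close> by less than \<open>D\<^sub>p(a) \<le> D\<^sub>t(a)\<close> in total.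
  Among the items with \<open>p\<^sub>i \<le> t\<close>, the one with the largest \<open>p\<^sub>i\<close> has its \<open>p\<^sub>i\<close> in all the
  intervals \<open>I\<close> of the others, so these items contribute at most \<open>2 D\<^sub>t(a)\<close>; symmetrically for \<open>p\<^sub>i > t\<close>.
\<close>

section \<open>Groups and leaders\<close>

definition lead :: "nat set \<Rightarrow> nat \<Rightarrow> nat" where
  "lead R l = Max {r \<in> R. r \<le> l}"

lemma lead_in:
  assumes "r \<in> R" "r \<le> l"
  shows "lead R l \<in> R" "lead R l \<le> l" "r \<le> lead R l"
proof -
  have fin: "finite {r \<in> R. r \<le> l}"
    by (rule finite_subset[of _ "{..l}"]) auto
  have "lead R l \<in> {r \<in> R. r \<le> l}"
    unfolding lead_def using fin assms by (intro Max_in) auto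
  then show "lead R l \<in> R" "lead R l \<le> l" by auto
  show "r \<le> lead R l"
    unfolding lead_def using fin assms by (intro Max_ge) auto
qed

lemma lead_eqI:
  assumes "r \<in> R" "r \<le> l" "\<And>s. s \<in> R \<Longrightarrow> s \<le> l \<Longrightarrow> s \<le> r"
  shows "lead R l = r"
  using lead_in[OF assms(1,2)] assms(3) by (metis order_antisym)

text \<open>Interval partitions of \<open>{a + 1..m}\<close>, encoded by the set \<open>R\<close> of
  left ends. The condition on \<open>a + 1\<close> gives every element a leader, so that
  \<open>lead\<close> never takes the maximum of an empty set there. Classes are constrained only
  below \<open>m\<close>, the domain of the extensional families.\<close>

definition groups :: "nat \<Rightarrow> nat \<Rightarrow> nat set \<Rightarrow> (nat \<Rightarrow> nat set) \<Rightarrow> bool" where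
  "groups m a R G \<longleftrightarrow> R \<subseteq> {a + 1..m} \<and> (a < m \<longrightarrow> a + 1 \<in> R) \<and>
     (\<forall>k<m. G k = {l \<in> {a + 1..m}. k = l - lead R l})"

lemma groups_lead:
  assumes "groups m a R G" "l \<in> {a + 1..m}"
  shows "lead R l \<in> R" "lead R l \<le> l" "a + 1 \<le> lead R l"
proof -
  have "a + 1 \<in> R" "a + 1 \<le> l" using assms by (auto simp: groups_def)
  from lead_in[OF this] show "lead R l \<in> R" "lead R l \<le> l" "a + 1 \<le> lead R l" by auto
qed

text \<open>Turns the membership test inside \<open>tau\<close> into a statement about leaders;
  \<open>1 \<le> j\<close> keeps the index \<open>l - j\<close> below \<open>m\<close>, where the
  classes are determined.\<close>

lemma groups_mem_iff:
  assumes "groups m a R G" "1 \<le> j" "j \<le> l" "l \<le> m"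
  shows "l \<in> G (l - j) \<longleftrightarrow> a + 1 \<le> l \<and> lead R l = j"
proof -
  have "l - j < m" using assms by auto
  then have "l \<in> G (l - j) \<longleftrightarrow> l \<in> {a + 1..m} \<and> l - j = l - lead R l"
    using assms(1) by (auto simp: groups_def)
  then show ?thesis
    using groups_lead[OF assms(1), of l] assms by auto
qed

lemma groups_roots:
  assumes "groups m a R G"
  shows "G 0 \<inter> {1..m} = R"
proof (rule set_eqI)
  fix l
  show "l \<in> G 0 \<inter> {1..m} \<longleftrightarrow> l \<in> R"
  proof (cases "l \<in> {a + 1..m}")
    case True
    then have "l \<in> G 0 \<longleftrightarrow> lead R l = l"
      using groups_mem_iff[OF assms, of l l] by auto
    moreover have "lead R l = l \<longleftrightarrow> l \<in> R"
      using groups_lead[OF assms True] lead_eqI[of l R l] by auto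
    ultimately show ?thesis using True by auto
  next
    case False
    then have "l \<notin> R" using assms by (auto simp: groups_def)
    moreover have "l \<notin> G 0 \<inter> {1..m}"
      using False assms unfolding groups_def by (cases "m = 0") auto
    ultimately show ?thesis by blast
  qed
qed

text \<open>The interval of \<open>j\<close> is merged into its predecessor, which starts at
  \<open>p\<close>. The bound \<open>q\<close> may lie beyond the next root, because a later root
  can be full after a tie; elements in between that have another leader are not in
  \<open>G (l - j)\<close> and keep their class.\<close>

lemma groups_move:
  assumes g: "groups m a R G" and j: "j \<in> R" "a + 1 < j"
    and p: "p \<in> R" "p < j" "\<And>r. r \<in> R \<Longrightarrow> r < j \<Longrightarrow> r \<le> p"
    and q: "\<And>l. l \<in> {a + 1..m} \<Longrightarrow> lead R l = j \<Longrightarrow> l < q" "q \<le> m + 1"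
    and G': "\<And>k. k < m \<Longrightarrow> G' k = (G k - {l \<in> {j..<q}. k = l - j}) \<union>
       {l \<in> {j..<q}. k = l - p \<and> l \<in> G (l - j)}"
  shows "groups m a (R - {j}) G'"
  unfolding groups_def
proof (intro conjI allI impI)
  have Rsub: "R \<subseteq> {a + 1..m}" and Ra: "a < m \<longrightarrow> a + 1 \<in> R" using g by (auto simp: groups_def)
  show "R - {j} \<subseteq> {a + 1..m}" using Rsub by auto
  show "a + 1 \<in> R - {j}" if "a < m" using Ra that j by auto
  have pa: "a + 1 \<le> p" using p Rsub by auto
  fix k assume k: "k < m"
  have lead': "lead (R - {j}) l = (if lead R l = j then p else lead R l)" if l: "l \<in> {a + 1..m}" for l
  proof (cases "lead R l = j")
    case True
    have "lead (R - {j}) l = p"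
    proof (rule lead_eqI)
      show "p \<in> R - {j}" using p by auto
      show "p \<le> l" using groups_lead[OF g l] True p by auto
      fix s assume s: "s \<in> R - {j}" "s \<le> l"
      then have "s \<le> j" using lead_in(3)[of s R l] True by auto
      then show "s \<le> p" using s p(3)[of s] by auto
    qed
    then show ?thesis using True by simp
  next
    case False
    have "lead (R - {j}) l = lead R l"
      using groups_lead[OF g l] False lead_in(3)[of _ R l] by (intro lead_eqI) auto
    then show ?thesis using False by simp
  qed
  show "G' k = {l \<in> {a + 1..m}. k = l - lead (R - {j}) l}"
  proof (rule set_eqI)
    fix l
    show "l \<in> G' k \<longleftrightarrow> l \<in> {l \<in> {a + 1..m}. k = l - lead (R - {j}) l}"
    proof (cases "l \<in> {a + 1..m}")
      case False
      then have "l \<notin> G k" using g k by (auto simp: groups_def)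
      moreover have "\<not> (l \<in> {j..<q} \<and> k = l - p \<and> l \<in> G (l - j))"
        using False q(2) j by auto
      ultimately show ?thesis using False G'[OF k] by auto
    next
      case True
      note ld = groups_lead[OF g True]
      have Gk: "l \<in> G k \<longleftrightarrow> k = l - lead R l" using g k True by (auto simp: groups_def)
      have Gj: "l \<in> G (l - j) \<longleftrightarrow> lead R l = j" if "j \<le> l"
        using groups_mem_iff[OF g, of j l] that True j by auto
      have G'k: "l \<in> G' k \<longleftrightarrow> l \<in> G k \<and> \<not> (l \<in> {j..<q} \<and> k = l - j) \<or>
          (l \<in> {j..<q} \<and> k = l - p \<and> l \<in> G (l - j))"
        using G'[OF k] by blast
      show ?thesis
      proof (cases "lead R l = j")
        case T: True
        have lq: "l \<in> {j..<q}" using q(1)[OF True T] ld T by simp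
        then have "l \<in> G' k \<longleftrightarrow> k = l - p" using G'k Gk Gj T by simp
        then show ?thesis using T True lead'[OF True] by simp
      next
        case F: False
        have "\<not> (l \<in> {j..<q} \<and> l \<in> G (l - j))" using Gj F by simp
        moreover have "\<not> (l \<in> {j..<q} \<and> k = l - j)" if "k = l - lead R l"
        proof
          assume "l \<in> {j..<q} \<and> k = l - j"
          then have "j \<le> l" "l - j = l - lead R l" using that by simp_all
          then show False using F ld(2) by linarith
        qed
        ultimately have "l \<in> G' k \<longleftrightarrow> l \<in> G k" using G'k Gk by blast
        then show ?thesis using F True Gk lead'[OF True] by simp
      qed
    qed
  qed
qed

text \<open>The first interval becomes a block: \<open>nr\<close> and \<open>mx\<close> say that it
  is exactly \<open>{a + 1..q}\<close>. If there are elements beyond \<open>q\<close>, then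
  \<open>q + 1\<close> is a root, so they keep their leaders.\<close>

lemma groups_drop:
  assumes g: "groups m a R G" and q: "a < q" "q \<le> m"
    and nr: "\<And>r. r \<in> R \<Longrightarrow> a + 1 < r \<Longrightarrow> q < r"
    and mx: "q < m \<Longrightarrow> q + 1 \<in> R"
    and G': "\<And>k. k < m \<Longrightarrow> G' k = G k - {..q}"
  shows "groups m q (R - {a + 1}) G'"
  unfolding groups_def
proof (intro conjI allI impI)
  have Rsub: "R \<subseteq> {a + 1..m}" using g by (auto simp: groups_def)
  show "R - {a + 1} \<subseteq> {q + 1..m}"
  proof
    fix r assume r: "r \<in> R - {a + 1}"
    then have "r \<in> {a + 1..m}" "r \<noteq> a + 1" using Rsub by auto
    then show "r \<in> {q + 1..m}" using nr[of r] r by auto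
  qed
  show "q + 1 \<in> R - {a + 1}" if "q < m" using mx that q by auto
  fix k assume k: "k < m"
  have lead': "lead (R - {a + 1}) l = lead R l" if l: "l \<in> {q + 1..m}" for l
  proof (rule lead_eqI)
    have l': "l \<in> {a + 1..m}" using l q by auto
    have "q + 1 \<le> lead R l" using lead_in(3)[of "q + 1" R l] mx l by auto
    then show "lead R l \<in> R - {a + 1}" using groups_lead[OF g l'] q by auto
    show "lead R l \<le> l" using groups_lead[OF g l'] by auto
    show "s \<le> lead R l" if "s \<in> R - {a + 1}" "s \<le> l" for s
      using lead_in(3)[of s R l] that by auto
  qed
  have Gk: "G k = {l \<in> {a + 1..m}. k = l - lead R l}" using g k unfolding groups_def by blast
  show "G' k = {l \<in> {q + 1..m}. k = l - lead (R - {a + 1}) l}"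
  proof (rule set_eqI)
    fix l
    have "l \<in> G' k \<longleftrightarrow> l \<in> {q + 1..m} \<and> k = l - lead R l"
      unfolding G'[OF k] Gk using q(1) by auto
    then show "l \<in> G' k \<longleftrightarrow> l \<in> {l \<in> {q + 1..m}. k = l - lead (R - {a + 1}) l}"
      using lead'[of l] by (simp only: mem_Collect_eq) metis
  qed
qed

text \<open>Each \<open>l\<close> up to the cap \<open>c\<close> is counted once, at its leader,
  which is at least \<open>a + 1\<close>.\<close>

lemma card_lead_sum:
  assumes g: "groups m a R G" and c: "c \<le> m"
  shows "(\<Sum>j\<in>{a + 1..x}. card {l \<in> {a + 1..c}. lead R l = j}) =
         card {l \<in> {a + 1..c}. lead R l \<le> x}"
proof -
  have "{l \<in> {a + 1..c}. lead R l \<le> x} = (\<Union>j\<in>{a + 1..x}. {l \<in> {a + 1..c}. lead R l = j})"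
  proof -
    have "a + 1 \<le> lead R l" if "l \<in> {a + 1..c}" for l
      using groups_lead(3)[OF g, of l] that c by simp
    then show ?thesis by (auto simp del: add_Suc_right Suc_eq_plus1)
  qed
  also have "card \<dots> = (\<Sum>j\<in>{a + 1..x}. card {l \<in> {a + 1..c}. lead R l = j})"
    by (rule card_UN_disjoint) auto
  finally show ?thesis by (rule sym)
qed

section \<open>Families of classes for all items, and the coefficients \<open>tau\<close>\<close>

lemma PiE_upd:
  assumes "f \<in> A \<rightarrow>\<^sub>E B" "x \<in> A" "y \<in> B"
  shows "f(x := y) \<in> A \<rightarrow>\<^sub>E B"
  using assms by (intro PiE_I) (auto dest: PiE_mem PiE_arb)

text \<open>The intersection takes care of \<open>mx P = 0\<close>: index 0 is then outside the
  domain of \<open>F i\<close>, and an extensional \<open>F i\<close> is \<open>undefined\<close>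
  there.\<close>

definition roots :: "'a ufp \<Rightarrow> 'a classes \<Rightarrow> 'a \<Rightarrow> nat set" where
  "roots P F i = F i 0 \<inter> {1..mx P}"

definition grouped :: "'a ufp \<Rightarrow> ('a \<Rightarrow> nat) \<Rightarrow> 'a classes \<Rightarrow> bool" where
  "grouped P a F \<longleftrightarrow> a \<in> items P \<rightarrow>\<^sub>E {0..mx P} \<and> F \<in> items P \<rightarrow>\<^sub>E ({..<mx P} \<rightarrow>\<^sub>E UNIV) \<and>
     (\<forall>i\<in>items P. groups (mx P) (a i) (roots P F i) (F i))"

lemma groupedD:
  assumes "grouped P a F" "i \<in> items P"
  shows "groups (mx P) (a i) (roots P F i) (F i)" "a i \<le> mx P"
  using assms by (auto simp: grouped_def dest: PiE_mem)

lemma finite_Hset: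
  assumes "finite (items P)"
  shows "finite (Hset P)"
proof (rule finite_subset)
  show "Hset P \<subseteq> {1..len P} \<times> (items P \<rightarrow>\<^sub>E {0..mx P}) \<times>
      (items P \<rightarrow>\<^sub>E ({..<mx P} \<rightarrow>\<^sub>E Pow {..mx P}))"
  proof
    fix h assume h: "h \<in> Hset P"
    obtain t a F where [simp]: "h = (t, a, F)" by (cases h)
    have F: "F \<in> items P \<rightarrow>\<^sub>E ({..<mx P} \<rightarrow>\<^sub>E UNIV)"
      and U: "\<And>i. i \<in> items P \<Longrightarrow> (\<Union>k<mx P. F i k) = {a i + 1..mx P}"
      using h by (auto simp: Hset_def)
    \<comment> \<open>In \<open>Hset\<close> the classes range over \<open>UNIV\<close>, but the
      union condition confines each of them to a finite set.\<close>
    have "F \<in> items P \<rightarrow>\<^sub>E ({..<mx P} \<rightarrow>\<^sub>E Pow {..mx P})"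
    proof (rule PiE_I)
      fix i assume i: "i \<in> items P"
      then have Fi: "F i \<in> {..<mx P} \<rightarrow>\<^sub>E UNIV" using F by (rule PiE_mem[rotated])
      show "F i \<in> {..<mx P} \<rightarrow>\<^sub>E Pow {..mx P}"
      proof (rule PiE_I)
        fix k assume "k \<in> {..<mx P}"
        then have "F i k \<subseteq> {a i + 1..mx P}" using U[OF i] by blast
        then show "F i k \<in> Pow {..mx P}" by auto
      qed (use Fi in \<open>auto dest: PiE_arb\<close>)
    qed (use F in \<open>auto dest: PiE_arb\<close>)
    then show "h \<in> {1..len P} \<times> (items P \<rightarrow>\<^sub>E {0..mx P}) \<times>
      (items P \<rightarrow>\<^sub>E ({..<mx P} \<rightarrow>\<^sub>E Pow {..mx P}))"
      using h by (auto simp: Hset_def)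
  qed
  show "finite ({1..len P} \<times> (items P \<rightarrow>\<^sub>E {0..mx P}) \<times>
      (items P \<rightarrow>\<^sub>E ({..<mx P} \<rightarrow>\<^sub>E Pow {..mx P})))"
    using assms by (intro finite_cartesian_product finite_PiE) auto
qed

text \<open>Ensures that the triple of the current state indexes a variable of the LP. Classes are
  disjoint because \<open>l\<close> has only one distance to its leader, and
  \<open>k + 1 \<le> j\<close> holds because leaders are positive.\<close>

lemma grouped_in_Hset:
  assumes "grouped P a F" "t \<in> {1..len P}"
  shows "(t, a, F) \<in> Hset P"
proof -
  have "disjoint_family_on (F i) {..<mx P} \<and> (\<Union>k<mx P. F i k) = {a i + 1..mx P} \<and>
        (\<forall>k<mx P. \<forall>j\<in>F i k. k + 1 \<le> j)" if i: "i \<in> items P" for i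
  proof -
    note g = groupedD(1)[OF assms(1) i]
    have F: "F i k = {l \<in> {a i + 1..mx P}. k = l - lead (roots P F i) l}" if "k < mx P" for k
      using g that by (auto simp: groups_def)
    note ld = groups_lead[OF g]
    have "disjoint_family_on (F i) {..<mx P}"
      by (auto simp: disjoint_family_on_def F)
    moreover have "(\<Union>k<mx P. F i k) = {a i + 1..mx P}"
    proof
      show "(\<Union>k<mx P. F i k) \<subseteq> {a i + 1..mx P}" using F by auto
      show "{a i + 1..mx P} \<subseteq> (\<Union>k<mx P. F i k)"
      proof
        fix l assume l: "l \<in> {a i + 1..mx P}"
        let ?k = "l - lead (roots P F i) l"
        have "?k < mx P" using ld[OF l] l by auto
        then show "l \<in> (\<Union>k<mx P. F i k)" using F[of ?k] l by auto
      qed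
    qed
    moreover have "k + 1 \<le> j" if "k < mx P" "j \<in> F i k" for k j
    proof -
      have "j \<in> {a i + 1..mx P}" "k = j - lead (roots P F i) j" using F that by auto
      then show ?thesis using ld[of j] by auto
    qed
    ultimately show ?thesis by blast
  qed
  then show ?thesis using assms by (auto simp: Hset_def grouped_def)
qed

lemma tau_grouped:
  assumes "grouped P a F" "i \<in> items P" "1 \<le> j"
  shows "tau P i j a F t = card {l \<in> {a i + 1..mcap P a t i}. lead (roots P F i) l = j}"
proof -
  note g = groupedD(1)[OF assms(1,2)]
  have c: "mcap P a t i \<le> mx P" by (simp add: mcap_def)
  have "{l. j \<le> l \<and> l \<in> F i (l - j) \<and> l \<le> mcap P a t i} =
        {l \<in> {a i + 1..mcap P a t i}. lead (roots P F i) l = j}"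
    using groups_mem_iff[OF g assms(3)] groups_lead(2)[OF g] c by auto
  then show ?thesis by (simp add: tau_def)
qed

text \<open>A root leads itself, so its interval meets the capped range as soon as the root does.
  This identifies the constraints that can stop a raise.\<close>

lemma tau_pos_iff:
  assumes "grouped P a F" "i \<in> items P" "1 \<le> j"
  shows "0 < tau P i j a F t \<longleftrightarrow> j \<in> roots P F i \<and> j \<le> mcap P a t i"
proof -
  note g = groupedD(1)[OF assms(1,2)]
  have c: "mcap P a t i \<le> mx P" by (simp add: mcap_def)
  have "0 < tau P i j a F t \<longleftrightarrow> (\<exists>l\<in>{a i + 1..mcap P a t i}. lead (roots P F i) l = j)"
    unfolding tau_grouped[OF assms] by (auto simp: card_gt_0_iff)
  also have "\<dots> \<longleftrightarrow> j \<in> roots P F i \<and> j \<le> mcap P a t i"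
  proof
    assume "\<exists>l\<in>{a i + 1..mcap P a t i}. lead (roots P F i) l = j"
    then obtain l where l: "l \<in> {a i + 1..mcap P a t i}" "lead (roots P F i) l = j" by blast
    then show "j \<in> roots P F i \<and> j \<le> mcap P a t i"
      using groups_lead[OF g, of l] c by auto
  next
    assume j: "j \<in> roots P F i \<and> j \<le> mcap P a t i"
    then have "j \<in> {a i + 1..mcap P a t i}" using g by (auto simp: groups_def)
    moreover have "lead (roots P F i) j = j" using j by (intro lead_eqI) auto
    ultimately show "\<exists>l\<in>{a i + 1..mcap P a t i}. lead (roots P F i) l = j" by blast
  qed
  finally show ?thesis .
qed

text \<open>Elements up to \<open>x\<close> have leaders up to \<open>x\<close>, so everything up to
  \<open>x\<close> and the cap is counted; an interval cut by \<open>x\<close> can only add to this.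
  Used for the competing solution.\<close>

lemma tau_sum_ge:
  assumes "grouped P a F" "i \<in> items P" "x \<le> mx P"
  shows "min (x - a i) (resid P a t) \<le> (\<Sum>j\<in>{a i + 1..x}. tau P i j a F t)"
proof -
  note g = groupedD(1)[OF assms(1,2)]
  have c: "mcap P a t i \<le> mx P" by (simp add: mcap_def)
  have "(\<Sum>j\<in>{a i + 1..x}. tau P i j a F t) =
        card {l \<in> {a i + 1..mcap P a t i}. lead (roots P F i) l \<le> x}"
    using card_lead_sum[OF g c, of x] tau_grouped[OF assms(1,2)] by simp
  moreover have "card {a i + 1..min x (mcap P a t i)} \<le>
        card {l \<in> {a i + 1..mcap P a t i}. lead (roots P F i) l \<le> x}"
    using groups_lead(2)[OF g] c by (intro card_mono) fastforce+
  moreover have "card {a i + 1..min x (mcap P a t i)} = min (x - a i) (resid P a t)"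
    using assms(3) by (auto simp: mcap_def)
  ultimately show ?thesis by simp
qed

text \<open>If an interval ends at \<open>x\<close>, elements above \<open>x\<close> have leaders
  above \<open>x\<close> and are not counted. Used for the output of the algorithm.\<close>

lemma tau_sum_le:
  assumes "grouped P a F" "i \<in> items P" "x \<le> mx P"
    and "a i < x \<Longrightarrow> x < mx P \<Longrightarrow> Suc x \<in> roots P F i"
  shows "(\<Sum>j\<in>{a i + 1..x}. tau P i j a F t) \<le> min (x - a i) (resid P a t)"
proof (cases "a i < x")
  case False
  then show ?thesis by simp
next
  case True
  note g = groupedD(1)[OF assms(1,2)]
  have c: "mcap P a t i \<le> mx P" by (simp add: mcap_def)
  have "(\<Sum>j\<in>{a i + 1..x}. tau P i j a F t) =
        card {l \<in> {a i + 1..mcap P a t i}. lead (roots P F i) l \<le> x}"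
    using card_lead_sum[OF g c, of x] tau_grouped[OF assms(1,2)] by simp
  moreover have "card {l \<in> {a i + 1..mcap P a t i}. lead (roots P F i) l \<le> x} \<le>
     card {a i + 1..min x (mcap P a t i)}"
  proof (intro card_mono subsetI)
    fix l assume l: "l \<in> {l \<in> {a i + 1..mcap P a t i}. lead (roots P F i) l \<le> x}"
    have "l \<le> x"
    proof (rule ccontr)
      assume "\<not> l \<le> x"
      then have "Suc x \<in> roots P F i" "Suc x \<le> l" using assms(4) True l c by auto
      from lead_in(3)[OF this] show False using l by auto
    qed
    then show "l \<in> {a i + 1..min x (mcap P a t i)}" using l by auto
  qed auto
  moreover have "card {a i + 1..min x (mcap P a t i)} = min (x - a i) (resid P a t)"
    using assms(3) by (auto simp: mcap_def)
  ultimately show ?thesis by simp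
qed

section \<open>Blocks and pruning\<close>

fun blev :: "'a block list \<Rightarrow> 'a \<Rightarrow> nat" where
  "blev [] i = 0"
| "blev ((i', j, b) # bs) i = (if i' = i then card b else 0) + blev bs i"

fun wf_blocks :: "'a block list \<Rightarrow> bool" where
  "wf_blocks [] \<longleftrightarrow> True"
| "wf_blocks ((i, j, b) # bs) \<longleftrightarrow> wf_blocks bs \<and> j = blev bs i + 1 \<and> (\<exists>q\<ge>j. b = {j..q})"

text \<open>The levels at which reverse deletion can leave item \<open>i\<close>, with 0 for an item
  without remaining blocks.\<close>

definition ends :: "'a block list \<Rightarrow> 'a \<Rightarrow> nat set" where
  "ends bs i = insert 0 {q. \<exists>j\<le>q. (i, j, {j..q}) \<in> set bs}"

text \<open>Pruning removes blocks of an item only from the top, so a level vector describes the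
  surviving set: for well-formed \<open>bs\<close> and \<open>x i\<close> in
  \<open>ends bs i\<close>, the test \<open>j \<le> x i\<close> selects the blocks inside
  \<open>{1..x i}\<close>.\<close>

definition blocks_upto :: "'a block list \<Rightarrow> ('a \<Rightarrow> nat) \<Rightarrow> 'a block set" where
  "blocks_upto bs x = {(i, j, b). (i, j, b) \<in> set bs \<and> j \<le> x i}"

lemma blev_append: "blev (ds @ bs) i = blev ds i + blev bs i"
  by (induction ds i rule: blev.induct) auto

lemma wf_blocks_append: "wf_blocks (ds @ bs) \<Longrightarrow> wf_blocks bs"
  by (induction ds) auto

lemma wf_blocks_mem:
  assumes "wf_blocks bs" "(i, j, b) \<in> set bs"
  shows "1 \<le> j \<and> j \<le> blev bs i \<and> (\<exists>q. b = {j..q} \<and> j \<le> q \<and> q \<le> blev bs i)"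
  using assms
proof (induction bs)
  case (Cons c bs)
  obtain i' j' b' where c: "c = (i', j', b')" by (cases c)
  show ?case
  proof (cases "(i, j, b) \<in> set bs")
    case True
    then have "1 \<le> j \<and> j \<le> blev bs i \<and> (\<exists>q. b = {j..q} \<and> j \<le> q \<and> q \<le> blev bs i)"
      using Cons by (auto simp: c)
    then show ?thesis by (auto simp: c)
  next
    case False
    then show ?thesis using Cons.prems by (auto simp: c)
  qed
qed simp

lemma ends_le_blev:
  assumes "wf_blocks bs" "q \<in> ends bs i"
  shows "q \<le> blev bs i"
proof (cases "q = 0")
  case False
  then obtain j where j: "j \<le> q" "(i, j, {j..q}) \<in> set bs" using assms(2) by (auto simp: ends_def)
  obtain q' where "{j..q} = {j..q'}" "q' \<le> blev bs i"
    using wf_blocks_mem[OF assms(1) j(2)] by blast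
  then show ?thesis using j(1) by (auto simp: Icc_eq_Icc)
qed simp

lemma blev_in_ends:
  assumes "wf_blocks bs"
  shows "blev bs i \<in> ends bs i"
  using assms
proof (induction bs)
  case (Cons c bs)
  obtain i' j' b' where c: "c = (i', j', b')" by (cases c)
  show ?case
  proof (cases "i' = i")
    case True
    then show ?thesis using Cons.prems by (auto simp: c ends_def)
  next
    case False
    then show ?thesis using Cons by (auto simp: c ends_def)
  qed
qed (simp add: ends_def)

lemma wf_blocks_later:
  assumes "wf_blocks (ds @ bs)" "(i, j, b) \<in> set ds"
  shows "blev bs i < j"
  using assms
proof (induction ds)
  case (Cons c ds)
  then show ?case by (cases c) (auto simp: blev_append)
qed simp

lemma sum_blocks_upto:
  assumes "wf_blocks bs" "x i \<in> ends bs i"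
  shows "(\<Sum>(i', j, b)\<in>{(i', j, b). (i', j, b) \<in> blocks_upto bs x \<and> i' = i}. card b) = x i"
  using assms
proof (induction bs arbitrary: x)
  case Nil
  then show ?case by (simp add: ends_def blocks_upto_def)
next
  case (Cons c bs)
  obtain i' j' b' where c: "c = (i', j', b')" by (cases c)
  then obtain q where wf: "wf_blocks bs" and j': "j' = blev bs i' + 1" and q: "j' \<le> q" "b' = {j'..q}"
    using Cons.prems by auto
  let ?S = "\<lambda>bs (x :: 'a \<Rightarrow> nat). {(i', j, b). (i', j, b) \<in> blocks_upto bs x \<and> i' = i}"
  have fin: "finite (?S bs x)" for x
    by (rule finite_subset[of _ "set bs"]) (auto simp: blocks_upto_def)
  show ?case
  proof (cases "i' = i \<and> x i = q")
    case False
    have "x i \<in> ends bs i"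
    proof -
      have "{j..x i} = {j'..q} \<longrightarrow> i' = i \<longrightarrow> \<not> j \<le> x i" for j using False q by (auto simp: Icc_eq_Icc)
      then show ?thesis using Cons.prems(2) q unfolding ends_def c by auto
    qed
    note e = this
    have "x i \<le> blev bs i" using e by (rule ends_le_blev[OF wf])
    then have "?S (c # bs) x = ?S bs x" using j' by (auto simp: blocks_upto_def c)
    then show ?thesis using Cons.IH[of x, OF wf e] by (simp only:)
  next
    case True
    \<comment> \<open>The end \<open>q\<close> of the newest block is not an end of the older ones,
      so the induction hypothesis is applied to the vector lowered to their top.\<close>
    let ?y = "x(i := blev bs i)"
    have le: "j \<le> blev bs i" if "(i, j, b) \<in> set bs" for j b
      using wf_blocks_mem[OF wf that] by auto
    have "?S (c # bs) x = insert (i, j', b') (?S bs ?y)"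
    proof -
      have "j \<le> x i" if "(i, j, b) \<in> set bs" for j b using le[OF that] True q j' by auto
      then show ?thesis using le True q by (auto simp: blocks_upto_def c)
    qed
    moreover have "(i, j', b') \<notin> ?S bs ?y" using True j' by (auto simp: blocks_upto_def)
    moreover have "(\<Sum>(i', j, b)\<in>?S bs ?y. card b) = blev bs i"
      using Cons.IH[of ?y, OF wf] blev_in_ends[OF wf, of i] by (simp only: fun_upd_same)
    ultimately have "(\<Sum>(i', j, b)\<in>?S (c # bs) x. card b) = card b' + blev bs i"
      using fin[of ?y] by (simp only: sum.insert) simp
    also have "\<dots> = x i" using True q j' by simp
    finally show ?thesis .
  qed
qed

lemma sol_blocks_upto:
  assumes "wf_blocks bs" "\<And>i. i \<in> items P \<Longrightarrow> x i \<in> ends bs i" "i \<in> items P"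
  shows "sol P (blocks_upto bs x) i = x i"
  using sum_blocks_upto[of bs x i] assms by (simp add: sol_def)

section \<open>Reverse deletion and its invariant\<close>

lemma covers_cong:
  assumes "\<And>i. i \<in> items P \<Longrightarrow> x i = y i"
  shows "covers P x \<longleftrightarrow> covers P y"
proof -
  have "(\<Sum>i\<in>{i\<in>items P. t \<in> ival P i}. x i) = (\<Sum>i\<in>{i\<in>items P. t \<in> ival P i}. y i)" for t
    using assms by (intro sum.cong) auto
  then show ?thesis by (simp add: covers_def)
qed

text \<open>
  When the block \<open>(i, j, {j..x i})\<close> was examined and kept, the older blocks \<open>rs\<close> were all still
  present; the maximum with \<open>blev rs\<close> records this, since they may be deleted later.
\<close>

definition needed :: "'a ufp \<Rightarrow> 'a block list \<Rightarrow> ('a \<Rightarrow> nat) \<Rightarrow> 'a \<Rightarrow> bool" where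
  "needed P bs x i \<longleftrightarrow> (\<exists>ds j rs. bs = ds @ (i, j, {j..x i}) # rs \<and>
     \<not> covers P ((\<lambda>i'. max (x i') (blev rs i'))(i := j - 1)))"

text \<open>Loop invariant of the deletion, where \<open>rs\<close> holds the blocks still to be
  examined. If \<open>x i\<close> exceeds \<open>blev rs i\<close>, then the topmost surviving block
  of \<open>i\<close> has been examined and kept.\<close>

definition pruned :: "'a ufp \<Rightarrow> 'a block list \<Rightarrow> 'a block list \<Rightarrow> ('a \<Rightarrow> nat) \<Rightarrow> bool" where
  "pruned P bs rs x \<longleftrightarrow> covers P x \<and>
     (\<forall>i\<in>items P. x i \<in> ends bs i \<and> blev rs i \<le> x i \<and> (blev rs i < x i \<longrightarrow> needed P bs x i))"

lemma not_covers_mono: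
  assumes "\<not> covers P x" "\<And>i. i \<in> items P \<Longrightarrow> y i \<le> x i"
  shows "\<not> covers P y"
proof -
  have "(\<Sum>i\<in>{i\<in>items P. t \<in> ival P i}. y i) \<le> (\<Sum>i\<in>{i\<in>items P. t \<in> ival P i}. x i)" for t
    using assms(2) by (intro sum_mono) auto
  then show ?thesis using assms(1) unfolding covers_def by (meson order_trans)
qed

text \<open>If a higher block of \<open>i\<close> survives, the order condition protects this one;
  otherwise it is on top and the covering test decides. Deletion lowers \<open>i\<close> to
  \<open>j - 1\<close>, which is \<open>blev rs i\<close>, so that \<open>needed\<close> is not
  demanded of \<open>i\<close>.\<close>

lemma prune_block_step:
  assumes wf: "wf_blocks bs" and bs: "bs = ds @ (i, j, b) # rs" and i: "i \<in> items P"
    and pr: "pruned P bs ((i, j, b) # rs) x"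
  shows "\<exists>y. pruned P bs rs y \<and> prune_block P (i, j, b) (blocks_upto bs x) = blocks_upto bs y"
proof -
  have wf': "wf_blocks ((i, j, b) # rs)" using wf wf_blocks_append bs by blast
  then obtain q where j: "j = blev rs i + 1" and q: "j \<le> q" "b = {j..q}" by auto
  have lv: "blev ((i, j, b) # rs) i = q" using j q by simp
  have lv': "blev ((i, j, b) # rs) i' = blev rs i'" if "i' \<noteq> i" for i' using that by simp
  have e: "\<And>i. i \<in> items P \<Longrightarrow> x i \<in> ends bs i" and cov: "covers P x"
    and ge: "\<And>i'. i' \<in> items P \<Longrightarrow> blev ((i, j, b) # rs) i' \<le> x i'"
    and nd: "\<And>i'. i' \<in> items P \<Longrightarrow> blev ((i, j, b) # rs) i' < x i' \<Longrightarrow> needed P bs x i'"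
    using pr by (auto simp: pruned_def)
  have later: "q < j'" if "(i, j', b') \<in> set ds" for j' b'
    using wf_blocks_later[of ds "(i, j, b) # rs" i j' b'] that wf bs lv by simp
  have earlier: "j' < j" if "(i, j', b') \<in> set rs" for j' b'
    using wf_blocks_mem[of rs i j' b'] that wf' j by simp
  have below: "(i, j', b') = (i, j, b) \<or> j' < j" if m: "(i, j', b') \<in> set bs" "j' \<le> q" for j' b'
  proof -
    consider "(i, j', b') \<in> set ds" | "(i, j', b') = (i, j, b)" | "(i, j', b') \<in> set rs"
      using m(1) bs by auto
    then show ?thesis
    proof cases
      case 1
      then show ?thesis using later[of j' b'] m(2) by simp
    next
      case 3
      then show ?thesis using earlier by blast
    qed blast
  qed
  let ?B = "blocks_upto bs x"
  have sol: "sol P ?B i' = x i'" if "i' \<in> items P" for i'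
    using sol_blocks_upto[OF wf e that] by blast
  have ge': "blev rs i' \<le> x i'" if "i' \<in> items P" for i'
    using ge[OF that] lv' lv j q by (cases "i' = i") auto
  show ?thesis
  proof (cases "q < x i")
    case True
    then obtain j' where j': "j' \<le> x i" "(i, j', {j'..x i}) \<in> set bs"
      using e[OF i] by (auto simp: ends_def)
    have "(i, j', {j'..x i}) \<in> set ds"
    proof -
      have "{j'..x i} \<noteq> {j..q}" using True j' by (auto simp: Icc_eq_Icc)
      moreover have "(i, j', {j'..x i}) \<notin> set rs"
      proof
        assume "(i, j', {j'..x i}) \<in> set rs"
        then have "x i \<in> ends rs i" using j'(1) by (auto simp: ends_def)
        then have "x i \<le> blev rs i" using ends_le_blev wf' by fastforce
        then show False using j q True by simp
      qed
      ultimately show ?thesis using j' bs q by auto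
    qed
    then have jj': "j < j'" using later[of j' "{j'..x i}"] q(1) by simp
    have "(i, j', {j'..x i}) \<in> ?B" using j' by (simp add: blocks_upto_def)
    then have "\<not> (\<forall>(i', j', b')\<in>?B. i' = i \<longrightarrow> j' \<le> j)" using jj' by fastforce
    then have "prune_block P (i, j, b) ?B = ?B" unfolding prune_block_def split by (simp only: simp_thms if_False)
    moreover have "pruned P bs rs x"
    proof -
      have "needed P bs x i'" if "i' \<in> items P" "blev rs i' < x i'" for i'
        using nd[OF that(1)] that(2) True lv lv'[of i'] by (cases "i' = i") simp_all
      then show ?thesis using cov e ge' unfolding pruned_def by blast
    qed
    ultimately show ?thesis by blast
  next
    case False
    then have xq: "x i = q" using ge[OF i] lv by simp
    have top: "\<forall>(i', j', b')\<in>?B. i' = i \<longrightarrow> j' \<le> j"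
    proof (intro ballI, clarify)
      fix j' b' assume "(i, j', b') \<in> ?B"
      then show "j' \<le> j" using below[of j' b'] xq by (auto simp: blocks_upto_def)
    qed
    let ?y = "x(i := j - 1)"
    have "sol P ?B i - card b = j - 1" using sol[OF i] xq q by simp
    then have cov_iff: "covers P ((sol P ?B)(i := sol P ?B i - card b)) \<longleftrightarrow> covers P ?y"
      using sol by (intro covers_cong) auto
    show ?thesis
    proof (cases "covers P ?y")
      case True
      then have "prune_block P (i, j, b) ?B = ?B - {(i, j, b)}"
        using cov_iff top by (simp add: prune_block_def)
      also have "\<dots> = blocks_upto bs ?y"
      proof (rule set_eqI)
        fix c :: "'a block"
        obtain i' j' b' where c: "c = (i', j', b')" by (cases c)
        show "c \<in> ?B - {(i, j, b)} \<longleftrightarrow> c \<in> blocks_upto bs ?y"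
        proof (cases "i' = i")
          case T: True
          have "j \<noteq> 0" using j by simp
          then show ?thesis
            using below[of j' b'] xq q(1) T by (auto simp: blocks_upto_def c)
        qed (auto simp: blocks_upto_def c)
      qed
      finally have 1: "prune_block P (i, j, b) ?B = blocks_upto bs ?y" .
      have "?y i' \<in> ends bs i' \<and> blev rs i' \<le> ?y i' \<and> (blev rs i' < ?y i' \<longrightarrow> needed P bs ?y i')"
        if i': "i' \<in> items P" for i'
      proof (cases "i' = i")
        case True
        have "blev rs i \<in> ends rs i" using wf' by (auto intro: blev_in_ends)
        then have "blev rs i \<in> ends bs i" by (auto simp: ends_def bs)
        then show ?thesis using True j by simp
      next
        case F: False
        have "needed P bs ?y i'" if "blev rs i' < x i'"
        proof -
          have "needed P bs x i'" using nd[OF i'] that lv'[OF F] by simp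
          then obtain ds' j' rs' where n: "bs = ds' @ (i', j', {j'..x i'}) # rs'"
            "\<not> covers P ((\<lambda>i''. max (x i'') (blev rs' i''))(i' := j' - 1))"
            by (auto simp: needed_def)
          \<comment> \<open>Lowering the level of \<open>i\<close> only lowers the vector that fails
            to cover, so earlier reasons for keeping blocks of other items persist.\<close>
          have "\<not> covers P ((\<lambda>i''. max (?y i'') (blev rs' i''))(i' := j' - 1))"
            by (rule not_covers_mono[OF n(2)]) (use xq q in auto)
          then show ?thesis using n(1) F unfolding needed_def by auto
        qed
        then show ?thesis using F e[OF i'] ge'[OF i'] by simp
      qed
      then have "pruned P bs rs ?y" using True by (simp add: pruned_def)
      with 1 show ?thesis by blast
    next
      case nc: False
      then have 1: "prune_block P (i, j, b) ?B = ?B"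
        using cov_iff by (simp add: prune_block_def)
      have "needed P bs x i"
        unfolding needed_def
      proof (intro exI conjI)
        show "bs = ds @ (i, j, {j..x i}) # rs" using bs q xq by simp
        \<comment> \<open>At this moment all of \<open>rs\<close> is still present, so the maximum
          is just \<open>x i'\<close>.\<close>
        show "\<not> covers P ((\<lambda>i'. max (x i') (blev rs i'))(i := j - 1))"
          by (rule not_covers_mono[OF nc]) (use ge' in auto)
      qed
      have "needed P bs x i'" if "i' \<in> items P" "blev rs i' < x i'" for i'
        using nd[OF that(1)] that(2) \<open>needed P bs x i\<close> lv'[of i'] by (cases "i' = i") simp_all
      then have "pruned P bs rs x" using cov e ge' unfolding pruned_def by blast
      with 1 show ?thesis by blast
    qed
  qed
qed

text \<open>The invariant starts with the level vector \<open>blev bs\<close>, where nothing has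
  been examined, and is carried through to the empty list.\<close>

lemma prune_pruned:
  assumes wf: "wf_blocks bs" and it: "\<And>i j b. (i, j, b) \<in> set bs \<Longrightarrow> i \<in> items P"
    and cov: "covers P (blev bs)"
  shows "pruned P bs [] (sol P (prune P bs))"
proof -
  have step: "\<exists>y. pruned P bs [] y \<and> fold (prune_block P) rs (blocks_upto bs x) = blocks_upto bs y"
    if "bs = ds @ rs" "pruned P bs rs x" for ds rs x
    using that
  proof (induction rs arbitrary: ds x)
    case Nil
    then show ?case by auto
  next
    case (Cons c rs)
    obtain i j b where c: "c = (i, j, b)" by (cases c)
    have "i \<in> items P" using it Cons.prems(1) c by auto
    then obtain y where y: "pruned P bs rs y"
        "prune_block P (i, j, b) (blocks_upto bs x) = blocks_upto bs y"
      using prune_block_step[OF wf Cons.prems(1)[unfolded c] _ Cons.prems(2)[unfolded c]] by blast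
    show ?case using Cons.IH[of "ds @ [c]" y] Cons.prems(1) y c by simp
  qed
  have "pruned P bs bs (blev bs)"
    using cov blev_in_ends[OF wf] by (simp add: pruned_def)
  then obtain y where y: "pruned P bs [] y"
      "fold (prune_block P) bs (blocks_upto bs (blev bs)) = blocks_upto bs y"
    using step[of "[]" bs] by auto
  have "blocks_upto bs (blev bs) = set bs"
    using wf_blocks_mem[OF wf] by (auto simp: blocks_upto_def)
  then have "prune P bs = blocks_upto bs y" using y by (simp add: prune_def)
  then have s: "sol P (prune P bs) i = y i" if "i \<in> items P" for i
    using sol_blocks_upto[OF wf _ that, of y] y by (auto simp: pruned_def)
  \<comment> \<open>The output is extensional and agrees with \<open>y\<close> only on the items, so
    \<open>needed\<close> has to be transferred; covering looks at items only.\<close>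
  have "needed P bs (sol P (prune P bs)) i" if i: "i \<in> items P" "0 < y i" for i
  proof -
    have "needed P bs y i" using y i by (auto simp: pruned_def)
    then obtain ds j rs where n: "bs = ds @ (i, j, {j..y i}) # rs"
        "\<not> covers P ((\<lambda>i'. max (y i') (blev rs i'))(i := j - 1))"
      by (auto simp: needed_def)
    have "\<not> covers P ((\<lambda>i'. max (sol P (prune P bs) i') (blev rs i'))(i := j - 1))"
      by (rule not_covers_mono[OF n(2)]) (use s in auto)
    then show ?thesis using n(1) s[OF i(1)] unfolding needed_def by auto
  qed
  moreover have "covers P (sol P (prune P bs))"
    using covers_cong[of P "sol P (prune P bs)" y, OF s] y(1) by (simp add: pruned_def)
  ultimately show ?thesis using s y by (auto simp: pruned_def)
qed

section \<open>Dual constraints\<close>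

lemma fcost_real:
  assumes "ufp_instance P" "i \<in> items P" "j \<le> mx P" "fcost P i j \<noteq> \<infinity>"
  obtains c where "0 \<le> c" "fcost P i j = ereal c"
proof -
  have "fcost P i j = \<infinity> \<or> (\<exists>c\<in>\<rat>. 0 \<le> c \<and> fcost P i j = ereal c)"
    using assms(1-3) by (simp add: ufp_instance_def)
  then show ?thesis using that assms(4) by blast
qed

lemma fcost_mono:
  assumes "ufp_instance P" "i \<in> items P" "j \<le> j'" "j' \<le> mx P"
  shows "fcost P i j \<le> fcost P i j'"
proof -
  have "mono_on {0..mx P} (fcost P i)" using assms by (auto simp: ufp_instance_def)
  then show ?thesis using assms by (auto simp: mono_on_def)
qed

lemma gcost_nonneg:
  assumes "ufp_instance P" "i \<in> items P" "j \<le> mx P"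
  shows "0 \<le> gcost P i j"
  unfolding gcost_def using fcost_mono[OF assms(1,2), of "j - 1" j] assms(3)
  by (intro ereal_diff_positive) auto

lemma gcost_finite:
  assumes "ufp_instance P" "i \<in> items P" "j \<le> mx P" "fcost P i j \<noteq> \<infinity>"
  shows "gcost P i j \<noteq> \<infinity>"
proof -
  obtain c where c: "fcost P i j = ereal c" using fcost_real[OF assms] by blast
  have "fcost P i (j - 1) \<le> fcost P i j" using fcost_mono[OF assms(1,2), of "j - 1" j] assms(3) by auto
  then have "fcost P i (j - 1) \<noteq> \<infinity>" using c by auto
  moreover have "j - 1 \<le> mx P" using assms(3) by simp
  ultimately obtain c' where "fcost P i (j - 1) = ereal c'"
    using fcost_real[OF assms(1,2)] by blast
  then show ?thesis using c by (simp add: gcost_def)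
qed

lemma dual_lhs_mono:
  assumes "\<And>h. v h \<le> v' h"
  shows "dual_lhs P v i j \<le> dual_lhs P v' i j"
  unfolding dual_lhs_def by (intro sum_mono) (auto intro!: mult_left_mono assms)

text \<open>Moves the conditions on \<open>i\<close> and \<open>j\<close> from the index set into
  the coefficient, so that sums over constraints and over triples can be exchanged.\<close>

lemma dual_lhs_alt:
  assumes "finite (items P)"
  shows "dual_lhs P v i j = (\<Sum>(t, a, F)\<in>Hset P.
     if t \<in> ival P i \<and> a i < j then real (tau P i j a F t) * v (t, a, F) else 0)"
  unfolding dual_lhs_def
  by (rule sum.mono_neutral_cong_left) (use finite_Hset[OF assms] in \<open>auto split: if_splits\<close>)

lemma dual_lhs_update:
  assumes "finite (items P)" "(t, a, F) \<in> Hset P"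
  shows "dual_lhs P (v((t, a, F) := v (t, a, F) + d)) i j = dual_lhs P v i j +
    (if t \<in> ival P i \<and> a i < j then real (tau P i j a F t) * d else 0)"
proof -
  let ?c = "\<lambda>(t, a, F). if t \<in> ival P i \<and> a i < j then real (tau P i j a F t) else 0"
  have alt: "dual_lhs P v i j = (\<Sum>h\<in>Hset P. ?c h * v h)" for v
    unfolding dual_lhs_alt[OF assms(1)] by (intro sum.cong) auto
  have "dual_lhs P (v((t, a, F) := v (t, a, F) + d)) i j =
      (\<Sum>h\<in>Hset P. ?c h * v h + (if h = (t, a, F) then ?c (t, a, F) * d else 0))"
    unfolding alt by (intro sum.cong) (auto simp: algebra_simps)
  also have "\<dots> = dual_lhs P v i j + ?c (t, a, F) * d"
    unfolding alt sum.distrib using finite_Hset[OF assms(1)] assms(2) by (simp only: sum.delta) simp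
  finally show ?thesis by simp
qed

text \<open>Fullness persists: raising variables can only increase the left-hand side, and
  feasibility bounds it by the right-hand side.\<close>

lemma full_mono:
  assumes "full P v i j" "\<And>h. v h \<le> v' h" "dual_feasible P v'" "i \<in> items P" "j \<in> {1..mx P}"
  shows "full P v' i j"
proof -
  have "gcost P i j \<le> ereal (dual_lhs P v' i j)"
    using assms(1) dual_lhs_mono[of v v' P i j, OF assms(2)] by (metis full_def ereal_less_eq(3))
  moreover have "ereal (dual_lhs P v' i j) \<le> gcost P i j"
    using assms(3-5) by (auto simp: dual_feasible_def)
  ultimately show ?thesis by (simp add: full_def)
qed

text \<open>The increments \<open>gcost\<close> telescope. By monotonicity a finite cost at
  \<open>x\<close> is finite at all lower levels, so all the differences are real.\<close>

lemma fcost_ge_dual_lhs: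
  assumes "ufp_instance P" "dual_feasible P v" "i \<in> items P"
  shows "x \<le> mx P \<Longrightarrow> fcost P i x \<noteq> \<infinity> \<Longrightarrow>
    fcost P i 0 + ereal (\<Sum>j\<in>{1..x}. dual_lhs P v i j) \<le> fcost P i x"
proof (induction x)
  case (Suc x)
  have le: "fcost P i x \<le> fcost P i (Suc x)" using fcost_mono[OF assms(1,3)] Suc.prems by simp
  obtain c' where c': "fcost P i (Suc x) = ereal c'"
    using fcost_real[OF assms(1,3) Suc.prems] by blast
  then have fin: "fcost P i x \<noteq> \<infinity>" using le by auto
  have "x \<le> mx P" using Suc.prems(1) by simp
  from fcost_real[OF assms(1,3) this fin] obtain c where c: "fcost P i x = ereal c" by blast
  have "fcost P i 0 \<le> fcost P i x" using fcost_mono[OF assms(1,3)] Suc.prems by simp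
  then have "fcost P i 0 \<noteq> \<infinity>" using c by auto
  from fcost_real[OF assms(1,3) le0 this] obtain c0 where c0: "fcost P i 0 = ereal c0" by blast
  have "ereal (dual_lhs P v i (Suc x)) \<le> gcost P i (Suc x)"
    using assms(2,3) Suc.prems(1) by (auto simp: dual_feasible_def)
  then have "dual_lhs P v i (Suc x) \<le> c' - c" using c c' by (simp add: gcost_def)
  moreover have "c0 + (\<Sum>j\<in>{1..x}. dual_lhs P v i j) \<le> c"
    using Suc.IH fin Suc.prems(1) c c0 by simp
  ultimately show ?case using c0 c' by simp
qed simp

text \<open>The same telescoping with equalities. A full constraint has a real right-hand side, so
  finiteness propagates upwards from level 0.\<close>

lemma fcost_eq_dual_lhs:
  assumes "ufp_instance P" "i \<in> items P" "fcost P i 0 \<noteq> \<infinity>"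
  shows "x \<le> mx P \<Longrightarrow> (\<And>j. j \<in> {1..x} \<Longrightarrow> full P v i j) \<Longrightarrow>
    fcost P i x = fcost P i 0 + ereal (\<Sum>j\<in>{1..x}. dual_lhs P v i j)"
proof (induction x)
  case (Suc x)
  obtain c0 where c0: "fcost P i 0 = ereal c0"
    using fcost_real[OF assms(1,2) le0 assms(3)] by blast
  have IH: "fcost P i x = ereal (c0 + (\<Sum>j\<in>{1..x}. dual_lhs P v i j))"
    using Suc c0 by simp
  have "full P v i (Suc x)" using Suc.prems by simp
  then have "fcost P i (Suc x) - fcost P i x = ereal (dual_lhs P v i (Suc x))"
    by (simp add: full_def gcost_def)
  then show ?case using IH c0 by (cases "fcost P i (Suc x)") auto
qed simp

section \<open>The growing phase\<close>

text \<open>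
  What the analysis has to remember about a triple whose dual variable was raised in the past:
  \<open>old\<close> are the blocks that existed at that time.
\<close>

definition hist :: "'a ufp \<Rightarrow> 'a state \<Rightarrow> 'a triple \<Rightarrow> bool" where
  "hist P s = (\<lambda>(t, a, F). t \<in> {1..len P} \<and> 0 < resid P a t \<and>
     (\<forall>t'\<in>{1..len P}. resid P a t' \<le> resid P a t) \<and> grouped P a F \<and>
     (\<exists>new old. blocks s = new @ old \<and> (\<forall>i\<in>items P. blev old i = a i)) \<and>
     (\<forall>i\<in>items P. roots P (cls s) i \<subseteq> roots P F i) \<and>
     (\<forall>i\<in>items P. \<forall>q\<in>ends (blocks s) i. a i < q \<longrightarrow> q < mx P \<longrightarrow> Suc q \<in> roots P F i))"

text \<open>Fullness of the non-roots pays for the output, because no element up to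
  \<open>lev s i\<close> is a root. The last conjunct reduces the weight estimates to triples
  satisfying \<open>hist\<close>.\<close>

definition grow_inv :: "'a ufp \<Rightarrow> 'a state \<Rightarrow> bool" where
  "grow_inv P s \<longleftrightarrow> grouped P (lev s) (cls s) \<and> dual_feasible P (dual s) \<and>
     (\<forall>i\<in>items P. \<forall>l\<in>{1..mx P}. l \<notin> roots P (cls s) i \<longrightarrow> full P (dual s) i l) \<and>
     wf_blocks (blocks s) \<and> (\<forall>i j b. (i, j, b) \<in> set (blocks s) \<longrightarrow> i \<in> items P) \<and>
     (\<forall>i\<in>items P. lev s i = blev (blocks s) i) \<and>
     (\<forall>h. dual s h \<noteq> 0 \<longrightarrow> hist P s h)"

lemma grow_invD:
  assumes "grow_inv P s"
  shows "grouped P (lev s) (cls s)" "dual_feasible P (dual s)"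
    and "\<And>i l. i \<in> items P \<Longrightarrow> l \<in> {1..mx P} \<Longrightarrow> l \<notin> roots P (cls s) i \<Longrightarrow> full P (dual s) i l"
    and "wf_blocks (blocks s)" "\<And>i j b. (i, j, b) \<in> set (blocks s) \<Longrightarrow> i \<in> items P"
    and "\<And>i. i \<in> items P \<Longrightarrow> lev s i = blev (blocks s) i"
    and "\<And>h. dual s h \<noteq> 0 \<Longrightarrow> hist P s h"
  using assms unfolding grow_inv_def by blast+

lemma roots_init:
  assumes "i \<in> items P"
  shows "roots P (cls (init P)) i = {1..mx P}"
  using assms by (auto simp: roots_def init_def restrict_def)

lemma grow_inv_init:
  assumes "ufp_instance P"
  shows "grow_inv P (init P)"
proof -
  have "groups (mx P) 0 {1..mx P} (\<lambda>k\<in>{..<mx P}. if k = 0 then {1..mx P} else {})"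
  proof -
    have "lead {1..mx P} l = l" if "l \<in> {1..mx P}" for l
      using that by (intro lead_eqI) auto
    then show ?thesis by (auto simp: groups_def)
  qed
  then have "grouped P (lev (init P)) (cls (init P))"
  proof -
    assume g: "groups (mx P) 0 {1..mx P} (\<lambda>k\<in>{..<mx P}. if k = 0 then {1..mx P} else {})"
    have "groups (mx P) (lev (init P) i) (roots P (cls (init P)) i) (cls (init P) i)"
      if "i \<in> items P" for i
      unfolding roots_init[OF that] using g that by (simp add: init_def)
    then show ?thesis by (auto simp: grouped_def init_def)
  qed
  moreover have "dual_feasible P (dual (init P))"
    using gcost_nonneg[OF assms]
    by (auto simp: dual_feasible_def init_def dual_lhs_def zero_ereal_def[symmetric])
  moreover have "blocks (init P) = []" "dual (init P) = (\<lambda>_. 0)" by (simp_all add: init_def)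
  moreover have "lev (init P) i = 0" if "i \<in> items P" for i
    using that by (simp add: init_def)
  ultimately show ?thesis
    unfolding grow_inv_def using roots_init[of _ P] by auto
qed

lemma raise_facts:
  assumes inv: "grow_inv P s" and r: "raise P s t v i j"
  shows "dual_feasible P v" "i \<in> items P" "j \<in> roots P (cls s) i" "full P v i j"
    and "\<And>i' l. i' \<in> items P \<Longrightarrow> l \<in> {1..mx P} \<Longrightarrow> l \<notin> roots P (cls s) i' \<Longrightarrow> full P v i' l"
    and "\<And>h. v h \<noteq> 0 \<Longrightarrow> hist P s h"
    and "\<And>r. r \<in> roots P (cls s) i \<Longrightarrow> r < j \<Longrightarrow> \<not> full P v i r"
proof -
  let ?h = "(t, lev s, cls s)"
  have g: "grouped P (lev s) (cls s)" using inv by (simp add: grow_inv_def)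
  obtain d where d: "0 \<le> d" "v = (dual s)(?h := dual s ?h + d)"
    and t: "t \<in> {1..len P}" "0 < resid P (lev s) t"
      "\<forall>t'\<in>{1..len P}. resid P (lev s) t' \<le> resid P (lev s) t"
    and df: "dual_feasible P v" and st: "stops P v ?h i j"
    and least: "\<And>i' j'. stops P v ?h i' j' \<Longrightarrow> j \<le> j'"
    using r by (auto simp: raise_def Let_def)
  show "dual_feasible P v" by (rule df)
  show i: "i \<in> items P" using st by (simp add: stops_def)
  have j: "j \<in> {1..mx P}" "full P v i j" "t \<in> ival P i" "0 < tau P i j (lev s) (cls s) t"
    using st by (auto simp: stops_def)
  show "full P v i j" by (rule j)
  have jr: "j \<in> roots P (cls s) i" "j \<le> mcap P (lev s) t i"
    using tau_pos_iff[OF g i, of j t] j by auto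
  show "j \<in> roots P (cls s) i" by (rule jr)
  show "full P v i' l" if "i' \<in> items P" "l \<in> {1..mx P}" "l \<notin> roots P (cls s) i'" for i' l
  proof (rule full_mono[OF _ _ df that(1,2)])
    show "full P (dual s) i' l" using grow_invD(3)[OF inv] that by blast
    show "dual s h \<le> v h" for h using d by simp
  qed
  show "hist P s h" if "v h \<noteq> 0" for h
  proof (cases "h = ?h")
    case True
    have "\<exists>new old. blocks s = new @ old \<and> (\<forall>i\<in>items P. blev old i = lev s i)"
      using grow_invD(6)[OF inv] by (intro exI[of _ "[]"] exI[of _ "blocks s"]) simp
    \<comment> \<open>No block ends above the current level, so the clause of \<open>hist\<close> on
      block ends is vacuous for the triple being raised.\<close>
    moreover have "q \<le> lev s i" if "i \<in> items P" "q \<in> ends (blocks s) i" for i q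
      using ends_le_blev[OF grow_invD(4)[OF inv] that(2)] grow_invD(6)[OF inv that(1)] by simp
    ultimately show ?thesis using t g unfolding True hist_def by fastforce
  next
    case False
    then show ?thesis using that d grow_invD(7)[OF inv] by simp
  qed
  show "\<not> full P v i r" if r: "r \<in> roots P (cls s) i" "r < j" for r
  proof
    assume "full P v i r"
    have "r \<in> {lev s i + 1..mx P}" using r(1) groupedD[OF g i] by (auto simp: groups_def)
    \<comment> \<open>The root \<open>r\<close> lies below the cap because \<open>j\<close> does; a
      full \<open>r\<close> would therefore stop the raise, and \<open>j\<close> would not be
      smallest.\<close>
    moreover from this have "0 < tau P i r (lev s) (cls s) t"
      using tau_pos_iff[OF g i, of r t] r jr by auto
    ultimately have "stops P v ?h i r" using i j \<open>full P v i r\<close> by (auto simp: stops_def)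
    then show False using least r(2) by fastforce
  qed
qed

text \<open>The common part of both kinds of growing step. New block ends need a successor that is a
  root before the step only, because the present roots are contained in those of every recorded
  triple.\<close>

lemma grow_inv_step:
  assumes inv: "grow_inv P s" and r: "raise P s t v i j"
    and g': "grouped P (lev s') (cls s')" and dual': "dual s' = v"
    and roots': "\<And>i'. i' \<in> items P \<Longrightarrow> roots P (cls s') i' =
        (if i' = i then roots P (cls s) i - {j} else roots P (cls s) i')"
    and bs': "blocks s' = ds @ blocks s" "wf_blocks (blocks s')"
    and it': "\<And>i j b. (i, j, b) \<in> set ds \<Longrightarrow> i \<in> items P"
    and lev': "\<And>i. i \<in> items P \<Longrightarrow> lev s' i = blev (blocks s') i"
    and ends': "\<And>i q. i \<in> items P \<Longrightarrow> q \<in> ends (blocks s') i \<Longrightarrow> q \<notin> ends (blocks s) i \<Longrightarrow>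
        q < mx P \<Longrightarrow> Suc q \<in> roots P (cls s) i"
  shows "grow_inv P s'"
proof -
  note rf = raise_facts[OF inv r]
  have "hist P s' h" if "v h \<noteq> 0" for h
  proof -
    obtain t a F where h: "h = (t, a, F)" by (cases h)
    have hs: "hist P s (t, a, F)" using rf(6)[OF that] h by simp
    have sub: "roots P (cls s') i' \<subseteq> roots P F i'" if "i' \<in> items P" for i'
      using hs roots'[OF that] rf(2) that by (auto simp: hist_def split: if_splits)
    have e: "Suc q \<in> roots P F i'"
      if "i' \<in> items P" "q \<in> ends (blocks s') i'" "a i' < q" "q < mx P" for i' q
    proof (cases "q \<in> ends (blocks s) i'")
      case True
      then show ?thesis using hs that by (simp add: hist_def)
    next
      case False
      then show ?thesis using ends'[OF that(1,2) False that(4)] hs that(1) by (auto simp: hist_def)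
    qed
    obtain new old where "blocks s = new @ old" "\<forall>i\<in>items P. blev old i = a i"
      using hs by (auto simp: hist_def)
    then have "\<exists>new old. blocks s' = new @ old \<and> (\<forall>i\<in>items P. blev old i = a i)"
      using bs'(1) by (intro exI[of _ "ds @ new"] exI[of _ old]) simp
    then show ?thesis using hs sub e by (simp add: hist_def h)
  qed
  moreover have "full P v i' l" if "i' \<in> items P" "l \<in> {1..mx P}" "l \<notin> roots P (cls s') i'" for i' l
    using roots'[OF that(1)] rf(4) rf(5)[OF that(1,2)] that(3) by (auto split: if_splits)
  moreover have "i' \<in> items P" if "(i', j', b') \<in> set (blocks s')" for i' j' b'
    using that grow_invD(5)[OF inv] it' bs'(1) by auto
  ultimately show ?thesis
    using g' rf(1) bs'(2) lev' unfolding grow_inv_def dual' by blast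
qed

lemma grow_step:
  assumes inv: "grow_inv P s" and gr: "grow P s s'"
  shows "grow_inv P s' \<and> (\<exists>i\<in>items P. \<exists>j\<in>roots P (cls s) i. \<forall>i'\<in>items P.
    roots P (cls s') i' = (if i' = i then roots P (cls s) i - {j} else roots P (cls s) i'))"
  using gr
proof cases
  case (regroup t v i j p q)
  note rf = raise_facts[OF inv regroup(2)]
  let ?R = "roots P (cls s) i"
  have gs: "grouped P (lev s) (cls s)" using inv by (simp add: grow_inv_def)
  note g = groupedD(1)[OF gs rf(2)]
  have Rsub: "?R \<subseteq> {lev s i + 1..mx P}" using g by (simp add: groups_def)
  \<comment> \<open>Non-roots are full, and \<open>p\<close> is not full.\<close>
  have pR: "p \<in> ?R"
    using rf(5)[OF rf(2), of p] regroup rf(3) Rsub by auto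
  have pmax: "r \<le> p" if "r \<in> ?R" "r < j" for r
    using rf(7)[OF that] regroup(7) that(2) by (metis not_le)
  \<comment> \<open>If \<open>q \<le> mx P\<close>, then \<open>q\<close> is not full, hence a root,
    so elements from \<open>q\<close> on have leaders beyond \<open>j\<close>.\<close>
  have lq: "l < q" if l: "l \<in> {lev s i + 1..mx P}" "lead ?R l = j" for l
  proof (rule ccontr)
    assume "\<not> l < q"
    then have q: "q \<le> l" "q \<le> mx P" using l by auto
    then have "\<not> full P v i q" using regroup by auto
    then have "q \<in> ?R" using rf(5)[OF rf(2), of q] q regroup by auto
    from lead_in(3)[OF this q(1)] show False using l(2) regroup by simp
  qed
  have g': "groups (mx P) (lev s i) (?R - {j}) (move P (cls s) i j p q i)"
  proof (rule groups_move[OF g rf(3) _ pR _ pmax lq])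
    show "lev s i + 1 < j" "p < j" "q \<le> mx P + 1" using regroup by auto
    show "move P (cls s) i j p q i k = (cls s i k - {l \<in> {j..<q}. k = l - j}) \<union>
       {l \<in> {j..<q}. k = l - p \<and> l \<in> cls s i (l - j)}" if "k < mx P" for k
      using that by (simp add: move_def)
  qed
  have roots': "roots P (cls s') i' = (if i' = i then ?R - {j} else roots P (cls s) i')" for i'
    using groups_roots[OF g'] regroup(1) by (simp add: roots_def move_def)
  have "grouped P (lev s') (cls s')"
  proof -
    have "cls s \<in> items P \<rightarrow>\<^sub>E ({..<mx P} \<rightarrow>\<^sub>E UNIV)" using gs by (simp add: grouped_def)
    then have "move P (cls s) i j p q \<in> items P \<rightarrow>\<^sub>E ({..<mx P} \<rightarrow>\<^sub>E UNIV)"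
      unfolding move_def by (rule PiE_upd[OF _ rf(2)]) auto
    then have "cls s' \<in> items P \<rightarrow>\<^sub>E ({..<mx P} \<rightarrow>\<^sub>E UNIV)" using regroup(1) by simp
    moreover have "groups (mx P) (lev s' i') (roots P (cls s') i') (cls s' i')"
      if "i' \<in> items P" for i'
      using g' groupedD(1)[OF gs that] roots'[of i'] regroup(1) by (cases "i' = i") (auto simp: move_def)
    ultimately show ?thesis using gs regroup(1) by (simp add: grouped_def)
  qed
  then have "grow_inv P s'"
  proof (rule grow_inv_step[OF inv regroup(2) _ _ roots'])
    show "dual s' = v" using regroup(1) by simp
    show "blocks s' = [] @ blocks s" using regroup(1) by simp
    show "wf_blocks (blocks s')" using regroup(1) grow_invD(4)[OF inv] by simp
    show "lev s' i' = blev (blocks s') i'" if "i' \<in> items P" for i'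
      using regroup(1) grow_invD(6)[OF inv that] by simp
  qed (use regroup(1) in simp_all)
  then show ?thesis using roots' rf(2,3) by blast
next
  case (new_block t v i j q)
  note rf = raise_facts[OF inv new_block(2)]
  let ?R = "roots P (cls s) i"
  let ?Q = "{q. lev s i < q \<and> q \<le> mx P \<and> (\<forall>j'\<in>{j+1..q}. j' \<notin> cls s i 0)}"
  have gs: "grouped P (lev s) (cls s)" using inv by (simp add: grow_inv_def)
  note g = groupedD(1)[OF gs rf(2)]
  have Rsub: "?R \<subseteq> {lev s i + 1..mx P}" using g by (simp add: groups_def)
  \<comment> \<open>A root exceeds the current level, so \<open>j\<close> can only be the first
    element of the first interval.\<close>
  have j: "j = lev s i + 1" "j \<le> mx P" using rf(3) Rsub new_block(3) by auto
  have finQ: "finite ?Q" by (rule finite_subset[of _ "{..mx P}"]) auto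
  have "j \<in> ?Q" using j by auto
  then have qQ: "q \<in> ?Q" unfolding new_block(4) using Max_in[OF finQ] by blast
  have qmax: "Suc q \<notin> ?Q"
  proof
    assume "Suc q \<in> ?Q"
    from Max_ge[OF finQ this] show False using new_block(4) by simp
  qed
  have q: "lev s i < q" "q \<le> mx P" and qn: "\<And>j'. j < j' \<Longrightarrow> j' \<le> q \<Longrightarrow> j' \<notin> cls s i 0"
    using qQ by auto
  have nr: "q < r" if "r \<in> ?R" "lev s i + 1 < r" for r
    using qn[of r] that j by (cases "r \<le> q") (auto simp: roots_def)
  \<comment> \<open>By maximality of \<open>q\<close>, the only thing that keeps
    \<open>Suc q\<close> out of \<open>?Q\<close> is that it is a root itself.\<close>
  have sucq: "q + 1 \<in> ?R" if qm: "q < mx P"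
  proof -
    obtain j' where "j' \<in> {j+1..Suc q}" "j' \<in> cls s i 0"
      using qmax qm q by auto
    then have "j' = Suc q" using qn[of j'] by (cases "j' = Suc q") auto
    then show ?thesis using \<open>j' \<in> cls s i 0\<close> qm by (simp add: roots_def)
  qed
  have g': "groups (mx P) q (?R - {j}) (drop_upto P (cls s) i q i)"
    unfolding j(1) by (rule groups_drop[OF g q nr sucq]) (auto simp: drop_upto_def)
  have roots': "roots P (cls s') i' = (if i' = i then ?R - {j} else roots P (cls s) i')" for i'
    using groups_roots[OF g'] new_block(1) by (simp add: roots_def drop_upto_def)
  have gr': "grouped P (lev s') (cls s')"
  proof -
    have "cls s \<in> items P \<rightarrow>\<^sub>E ({..<mx P} \<rightarrow>\<^sub>E UNIV)" using gs by (simp add: grouped_def)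
    then have "drop_upto P (cls s) i q \<in> items P \<rightarrow>\<^sub>E ({..<mx P} \<rightarrow>\<^sub>E UNIV)"
      unfolding drop_upto_def by (rule PiE_upd[OF _ rf(2)]) auto
    then have "cls s' \<in> items P \<rightarrow>\<^sub>E ({..<mx P} \<rightarrow>\<^sub>E UNIV)" using new_block(1) by simp
    moreover have "lev s' \<in> items P \<rightarrow>\<^sub>E {0..mx P}"
    proof -
      have "lev s \<in> items P \<rightarrow>\<^sub>E {0..mx P}" using gs by (simp add: grouped_def)
      from PiE_upd[OF this rf(2), of q] show ?thesis using new_block(1) q by simp
    qed
    moreover have "groups (mx P) (lev s' i') (roots P (cls s') i') (cls s' i')"
      if "i' \<in> items P" for i'
      using g' groupedD(1)[OF gs that] roots'[of i'] new_block(1)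
      by (cases "i' = i") (auto simp: drop_upto_def)
    ultimately show ?thesis by (simp add: grouped_def)
  qed
  have lv: "lev s i = blev (blocks s) i" by (rule grow_invD(6)[OF inv rf(2)])
  have bs': "blocks s' = (i, j, {j..q}) # blocks s" using new_block(1) by simp
  have wf: "wf_blocks (blocks s')"
    using grow_invD(4)[OF inv] lv j q bs' by auto
  have "grow_inv P s'"
  proof (rule grow_inv_step[OF inv new_block(2) gr' _ roots' _ wf])
    show "dual s' = v" using new_block(1) by simp
    show "blocks s' = [(i, j, {j..q})] @ blocks s" using bs' by simp
    show "\<And>i' j' b'. (i', j', b') \<in> set [(i, j, {j..q})] \<Longrightarrow> i' \<in> items P" using rf(2) by simp
    show "lev s' i' = blev (blocks s') i'" if "i' \<in> items P" for i'
      using grow_invD(6)[OF inv that] lv j q new_block(1) by auto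
    show "Suc q' \<in> roots P (cls s) i'"
      if "i' \<in> items P" "q' \<in> ends (blocks s') i'" "q' \<notin> ends (blocks s) i'" "q' < mx P" for i' q'
    proof -
      have "i' = i \<and> q' = q" using that(2,3) bs' q j by (auto simp: ends_def Icc_eq_Icc)
      then show ?thesis using sucq that(4) by simp
    qed
  qed
  then show ?thesis using roots' rf(2,3) by blast
qed

text \<open>The potential is the total number of roots: it starts at
  \<open>card (items P) * mx P\<close> and drops in every step.\<close>

lemma grow_steps:
  assumes "ufp_instance P" "(grow P ^^ n) (init P) s"
  shows "grow_inv P s \<and> (\<Sum>i\<in>items P. card (roots P (cls s) i)) + n \<le> card (items P) * mx P"
  using assms(2)
proof (induction n arbitrary: s)
  case 0
  then have s: "s = init P" by simp
  have "(\<Sum>i\<in>items P. card (roots P (cls (init P)) i)) = (\<Sum>i\<in>items P. mx P)"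
    by (intro sum.cong) (simp_all add: roots_init)
  then show ?case using grow_inv_init[OF assms(1)] unfolding s by simp
next
  case (Suc n)
  then obtain s0 where s0: "(grow P ^^ n) (init P) s0" "grow P s0 s" by auto
  have fin: "finite (items P)" using assms(1) by (simp add: ufp_instance_def)
  note IH = Suc.IH[OF s0(1)]
  obtain i j where i: "i \<in> items P" and j: "j \<in> roots P (cls s0) i"
    and r: "\<forall>i'\<in>items P. roots P (cls s) i' =
      (if i' = i then roots P (cls s0) i - {j} else roots P (cls s0) i')"
    using grow_step[OF _ s0(2)] IH by blast
  have "(\<Sum>i\<in>items P. card (roots P (cls s) i)) < (\<Sum>i\<in>items P. card (roots P (cls s0) i))"
  proof (rule sum_strict_mono_ex1[OF fin])
    have f: "finite (roots P (cls s0) i')" for i' by (simp add: roots_def)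
    show "\<forall>x\<in>items P. card (roots P (cls s) x) \<le> card (roots P (cls s0) x)"
      using r f by (auto intro!: card_mono)
    have "card (roots P (cls s) i) < card (roots P (cls s0) i)"
      using r i j f by (simp add: card_Diff1_less del: card_Diff_insert)
    then show "\<exists>a\<in>items P. card (roots P (cls s) a) < card (roots P (cls s0) a)" using i by blast
  qed
  then show ?case using IH grow_step[OF _ s0(2)] by auto
qed

section \<open>The growing phase does not get stuck\<close>

lemma fcost_finite_if_cost_finite:
  assumes "ufp_instance P" "cost P x < \<infinity>" "i \<in> items P"
  shows "fcost P i (x i) \<noteq> \<infinity>"
proof
  assume "fcost P i (x i) = \<infinity>"
  moreover have "finite (items P)" using assms(1) by (simp add: ufp_instance_def)
  ultimately have "cost P x = \<infinity>" unfolding cost_def using assms(3) by (auto simp: sum_Pinfty)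
  then show False using assms(2) by simp
qed

lemma raise_exists:
  assumes inst: "ufp_instance P" and x: "x \<in> feasible P" "cost P x < \<infinity>"
    and inv: "grow_inv P s" and nf: "\<not> finished P s"
  shows "\<exists>t v i j. raise P s t v i j"
proof -
  have fin: "finite (items P)" using inst by (simp add: ufp_instance_def)
  let ?a = "lev s" and ?F = "cls s" and ?v = "dual s"
  note g = grow_invD(1)[OF inv]
  have "Max (resid P ?a ` {1..len P}) \<in> resid P ?a ` {1..len P}"
    using nf by (intro Max_in) (auto simp: finished_def)
  then obtain t where t: "t \<in> {1..len P}" "resid P ?a t = Max (resid P ?a ` {1..len P})" by auto
  have tmax: "\<forall>t'\<in>{1..len P}. resid P ?a t' \<le> resid P ?a t"
    unfolding t(2) by (auto intro: Max_ge)
  then have tpos: "0 < resid P ?a t" using nf by (fastforce simp: finished_def)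
  let ?h = "(t, ?a, ?F)"
  note hH = grouped_in_Hset[OF g t(1)]
  let ?tau = "\<lambda>i j. tau P i j ?a ?F t"
  let ?act = "\<lambda>i j. t \<in> ival P i \<and> ?a i < j \<and> 0 < ?tau i j"
  \<comment> \<open>The constraints that limit the raise: positive coefficient and finite right-hand
    side. The ratio \<open>slack\<close> is the increase that such a constraint permits.\<close>
  define C where "C = {(i, j). i \<in> items P \<and> j \<in> {1..mx P} \<and> ?act i j \<and> gcost P i j \<noteq> \<infinity>}"
  define slack where "slack = (\<lambda>(i, j). (real_of_ereal (gcost P i j) - dual_lhs P ?v i j) / real (?tau i j))"
  have finC: "finite C"
    by (rule finite_subset[of _ "items P \<times> {1..mx P}"]) (auto simp: C_def fin)
  have greal: "gcost P i j = ereal (real_of_ereal (gcost P i j))"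
    if "i \<in> items P" "j \<in> {1..mx P}" "gcost P i j \<noteq> \<infinity>" for i j
    using gcost_nonneg[OF inst that(1), of j] that by (auto simp: ereal_real)
  have lhs_le: "dual_lhs P ?v i j \<le> real_of_ereal (gcost P i j)"
    if "i \<in> items P" "j \<in> {1..mx P}" "gcost P i j \<noteq> \<infinity>" for i j
  proof -
    have "ereal (dual_lhs P ?v i j) \<le> gcost P i j"
      using grow_invD(2)[OF inv] that by (auto simp: dual_feasible_def)
    then show ?thesis by (subst (asm) greal[OF that]) simp
  qed
  \<comment> \<open>The solution \<open>x\<close> covers \<open>t\<close> but the current levels do
    not, so some item with \<open>t\<close> in its interval has \<open>?a i < x i\<close>. Its next
    element is a root, and its increment is finite because the cost of \<open>x\<close> is.\<close>
  have "C \<noteq> {}"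
  proof -
    let ?S = "{i \<in> items P. t \<in> ival P i}"
    have "dem P t \<le> (\<Sum>i\<in>?S. x i)" using x(1) t(1) by (auto simp: feasible_def covers_def)
    then have "(\<Sum>i\<in>?S. ?a i) < (\<Sum>i\<in>?S. x i)" using tpos by (simp add: resid_def)
    then obtain i where i: "i \<in> ?S" "?a i < x i" by (meson not_le sum_mono)
    have iN: "i \<in> items P" using i by simp
    have xm: "x i \<le> mx P" using x(1) iN by (auto simp: feasible_def dest: PiE_mem)
    have "fcost P i (?a i + 1) \<le> fcost P i (x i)" using fcost_mono[OF inst iN] i xm by simp
    then have "fcost P i (?a i + 1) \<noteq> \<infinity>"
      using fcost_finite_if_cost_finite[OF inst x(2) iN] by auto
    then have "gcost P i (?a i + 1) \<noteq> \<infinity>" using gcost_finite[OF inst iN] i xm by simp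
    moreover have "?a i + 1 \<in> roots P ?F i" using groupedD(1)[OF g iN] i xm by (simp add: groups_def)
    then have "0 < ?tau i (?a i + 1)"
      using tau_pos_iff[OF g iN, of "?a i + 1" t] tpos i xm by (simp add: mcap_def)
    ultimately have "(i, ?a i + 1) \<in> C" using i xm by (simp add: C_def)
    then show ?thesis by blast
  qed
  define d where "d = Min (slack ` C)"
  define v where "v = ?v(?h := ?v ?h + d)"
  have "d \<in> slack ` C" unfolding d_def using finC \<open>C \<noteq> {}\<close> by (intro Min_in) auto
  then obtain i0 j0 where ij0: "(i0, j0) \<in> C" "d = slack (i0, j0)" by auto
  have d0: "0 \<le> d"
    unfolding ij0(2) slack_def using lhs_le[of i0 j0] ij0(1) by (simp add: C_def)
  have lhs: "dual_lhs P v i j = dual_lhs P ?v i j + (if t \<in> ival P i \<and> ?a i < j then real (?tau i j) * d else 0)" for i j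
    unfolding v_def by (rule dual_lhs_update[OF fin hH])
  have df: "dual_feasible P v"
    unfolding dual_feasible_def
  proof (intro conjI ballI)
    show "0 \<le> v h" if "h \<in> Hset P" for h
      using grow_invD(2)[OF inv] that d0 hH by (simp add: v_def dual_feasible_def)
    fix i j assume ij: "i \<in> items P" "j \<in> {1..mx P}"
    show "ereal (dual_lhs P v i j) \<le> gcost P i j"
    proof (cases "gcost P i j = \<infinity>")
      case False
      have "dual_lhs P v i j \<le> real_of_ereal (gcost P i j)"
      proof (cases "?act i j")
        case True
        then have "(i, j) \<in> C" using ij False by (simp add: C_def)
        then have "d \<le> slack (i, j)" unfolding d_def using finC by simp
        then have "real (?tau i j) * d \<le> real_of_ereal (gcost P i j) - dual_lhs P ?v i j"
          using True by (simp add: slack_def field_simps)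
        then show ?thesis unfolding lhs using True by simp
      next
        case F: False
        then have "dual_lhs P v i j = dual_lhs P ?v i j" unfolding lhs by auto
        then show ?thesis using lhs_le[OF ij False] by simp
      qed
      then show ?thesis by (subst greal[OF ij False]) simp
    qed simp
  qed
  have "stops P v ?h i0 j0"
  proof -
    have c: "i0 \<in> items P" "j0 \<in> {1..mx P}" "?act i0 j0" "gcost P i0 j0 \<noteq> \<infinity>"
      using ij0(1) by (auto simp: C_def)
    have "dual_lhs P v i0 j0 = real_of_ereal (gcost P i0 j0)"
      unfolding lhs ij0(2) slack_def using c(3) by simp
    then have "full P v i0 j0" unfolding full_def by (subst greal[OF c(1,2,4)]) simp
    then show ?thesis using c by (simp add: stops_def)
  qed
  then have ex: "\<exists>j i. stops P v ?h i j" by blast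
  \<comment> \<open>Several constraints may attain the minimum slack, so the smallest
    \<open>j\<close> is chosen among all that now stop the raise.\<close>
  define j where "j = (LEAST j. \<exists>i. stops P v ?h i j)"
  obtain i where i: "stops P v ?h i j" using LeastI_ex[OF ex] unfolding j_def by blast
  have "j \<le> j'" if "stops P v ?h i' j'" for i' j'
    unfolding j_def by (rule Least_le) (use that in blast)
  then have "raise P s t v i j"
    unfolding raise_def Let_def using t(1) tmax tpos df i d0 v_def by blast
  then show ?thesis by blast
qed

lemma grow_progress:
  assumes inst: "ufp_instance P" and x: "x \<in> feasible P" "cost P x < \<infinity>"
    and inv: "grow_inv P s" and nf: "\<not> finished P s"
  shows "\<exists>s'. grow P s s'"
proof -
  obtain t v i j where r: "raise P s t v i j" using raise_exists[OF assms] by blast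
  note rf = raise_facts[OF inv r]
  note g = groupedD(1)[OF grow_invD(1)[OF inv] rf(2)]
  show ?thesis
  proof (cases "j > lev s i + 1")
    case False
    show ?thesis using grow.new_block[OF r False refl] by blast
  next
    case True
    have jm: "j \<le> mx P" "lev s i < mx P" using rf(3) g by (auto simp: groups_def)
    let ?A = "{p. 1 \<le> p \<and> p < j \<and> \<not> full P v i p}"
    have finA: "finite ?A" by (rule finite_subset[of _ "{..<j}"]) auto
    \<comment> \<open>The first root is below \<open>j\<close>, hence not full, so a candidate for
      \<open>p\<close> exists.\<close>
    have "lev s i + 1 \<in> roots P (cls s) i" using g jm by (simp add: groups_def)
    then have "lev s i + 1 \<in> ?A" using rf(7) True by auto
    then have p: "Max ?A \<in> ?A" using Max_in[OF finA] by blast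
    have pmax: "\<forall>r. Max ?A < r \<and> r < j \<longrightarrow> full P v i r"
    proof (intro allI impI, rule ccontr)
      fix r assume "Max ?A < r \<and> r < j" "\<not> full P v i r"
      then have "r \<in> ?A" by auto
      from Max_ge[OF finA this] show False using \<open>Max ?A < r \<and> r < j\<close> by simp
    qed
    \<comment> \<open>The sentinel \<open>mx P + 1\<close> always qualifies, so the least
      \<open>q\<close> exists.\<close>
    define Q where "Q q \<longleftrightarrow> j < q \<and> (q = mx P + 1 \<or> \<not> full P v i q)" for q
    define q where "q = (LEAST q. Q q)"
    have Q1: "Q (mx P + 1)" using jm by (simp add: Q_def)
    have "Q q" unfolding q_def by (rule LeastI[of Q, OF Q1])
    moreover have "q \<le> mx P + 1" unfolding q_def by (rule Least_le[of Q, OF Q1])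
    moreover have "full P v i r" if "j < r" "r < q" for r
      using not_less_Least[of r Q] that by (auto simp: Q_def q_def)
    ultimately show ?thesis
      using grow.regroup[OF r True _ _ _ pmax, of q] p unfolding Q_def by blast
  qed
qed

section \<open>Weak duality and the approximation factor\<close>

text \<open>The total coefficient of the variable of \<open>(t, a, F)\<close> in the constraints
  \<open>(i, j)\<close> with \<open>j \<le> x i\<close>, that is, in those paid for by
  \<open>x\<close>.\<close>

definition weight :: "'a ufp \<Rightarrow> ('a \<Rightarrow> nat) \<Rightarrow> 'a triple \<Rightarrow> nat" where
  "weight P x = (\<lambda>(t, a, F). \<Sum>i\<in>{i \<in> items P. t \<in> ival P i}. \<Sum>j\<in>{a i + 1..x i}. tau P i j a F t)"

lemma sum_dual_lhs_eq_weight: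
  assumes "finite (items P)"
  shows "(\<Sum>i\<in>items P. \<Sum>j\<in>{1..x i}. dual_lhs P v i j) = (\<Sum>h\<in>Hset P. real (weight P x h) * v h)"
proof -
  let ?c = "\<lambda>i j (t, a, F). if t \<in> ival P i \<and> a i < j then real (tau P i j a F t) else 0"
  have alt: "dual_lhs P v i j = (\<Sum>h\<in>Hset P. ?c i j h * v h)" for i j
    unfolding dual_lhs_alt[OF assms] by (intro sum.cong) auto
  have w: "(\<Sum>i\<in>items P. \<Sum>j\<in>{1..x i}. ?c i j h) = real (weight P x h)" for h
  proof -
    obtain t a F where h: "h = (t, a, F)" by (cases h)
    have inner: "(\<Sum>j\<in>{1..x i}. ?c i j h) =
        (if t \<in> ival P i then \<Sum>j\<in>{a i + 1..x i}. real (tau P i j a F t) else 0)" for i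
    proof (cases "t \<in> ival P i")
      case True
      have "(\<Sum>j\<in>{1..x i}. ?c i j h) = (\<Sum>j\<in>{a i + 1..x i}. real (tau P i j a F t))"
        by (rule sum.mono_neutral_cong_right) (auto simp: h True)
      then show ?thesis using True by simp
    qed (simp add: h)
    have "(\<Sum>i\<in>items P. \<Sum>j\<in>{1..x i}. ?c i j h) = (\<Sum>i\<in>items P.
        if t \<in> ival P i then \<Sum>j\<in>{a i + 1..x i}. real (tau P i j a F t) else 0)"
      by (simp only: inner)
    also have "\<dots> = real (weight P x h)"
      unfolding weight_def h split of_nat_sum by (rule sum.inter_filter[OF assms, symmetric])
    finally show ?thesis .
  qed
  have "(\<Sum>i\<in>items P. \<Sum>j\<in>{1..x i}. dual_lhs P v i j) =
        (\<Sum>i\<in>items P. \<Sum>h\<in>Hset P. \<Sum>j\<in>{1..x i}. ?c i j h * v h)"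
    unfolding alt by (intro sum.cong refl sum.swap)
  also have "\<dots> = (\<Sum>h\<in>Hset P. \<Sum>i\<in>items P. \<Sum>j\<in>{1..x i}. ?c i j h * v h)"
    by (rule sum.swap)
  also have "\<dots> = (\<Sum>h\<in>Hset P. (\<Sum>i\<in>items P. \<Sum>j\<in>{1..x i}. ?c i j h) * v h)"
    by (simp only: sum_distrib_right)
  also have "\<dots> = (\<Sum>h\<in>Hset P. real (weight P x h) * v h)" unfolding w ..
  finally show ?thesis .
qed

text \<open>The knapsack-cover argument: either one item alone supplies the residual demand, or no
  term is truncated and feasibility of \<open>x\<close> gives the bound.\<close>

lemma weight_ge_resid:
  assumes fin: "finite (items P)" and g: "grouped P a F" and t: "t \<in> {1..len P}"
    and x: "x \<in> feasible P"
  shows "resid P a t \<le> weight P x (t, a, F)"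
proof -
  let ?S = "{i \<in> items P. t \<in> ival P i}" and ?D = "resid P a t"
  have finS: "finite ?S" using fin by simp
  have "?D \<le> (\<Sum>i\<in>?S. min (x i - a i) ?D)"
  proof (cases "\<exists>i\<in>?S. ?D \<le> x i - a i")
    case True
    then obtain i where i: "i \<in> ?S" "?D \<le> x i - a i" by blast
    have "min (x i - a i) ?D \<le> (\<Sum>i\<in>?S. min (x i - a i) ?D)"
      using member_le_sum[OF i(1), of "\<lambda>i. min (x i - a i) ?D"] finS by simp
    then show ?thesis using i(2) by simp
  next
    case False
    then have "(\<Sum>i\<in>?S. min (x i - a i) ?D) = (\<Sum>i\<in>?S. x i - a i)"
      by (intro sum.cong) auto
    moreover have "(\<Sum>i\<in>?S. x i) \<le> (\<Sum>i\<in>?S. x i - a i) + (\<Sum>i\<in>?S. a i)"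
      unfolding sum.distrib[symmetric] by (intro sum_mono) auto
    moreover have "dem P t \<le> (\<Sum>i\<in>?S. x i)" using x t by (auto simp: feasible_def covers_def)
    ultimately show ?thesis by (simp add: resid_def)
  qed
  also have "\<dots> \<le> weight P x (t, a, F)"
    unfolding weight_def split
  proof (rule sum_mono)
    fix i assume i: "i \<in> ?S"
    then have "x i \<le> mx P" using x by (auto simp: feasible_def dest: PiE_mem)
    then show "min (x i - a i) ?D \<le> (\<Sum>j\<in>{a i + 1..x i}. tau P i j a F t)"
      using tau_sum_ge[OF g] i by simp
  qed
  finally show ?thesis .
qed

text \<open>Here \<open>old\<close> is the block list at the time of the triple. The top block of
  \<open>i\<close> is newer, so when it was examined all of \<open>old\<close> was still present;
  without it, levels at least \<open>a\<close> failed to cover some \<open>t\<close>.\<close>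

lemma needed_witness:
  assumes fin: "finite (items P)" and wf: "wf_blocks bs" and bs: "bs = new @ old"
    and a: "\<And>i. i \<in> items P \<Longrightarrow> blev old i = a i"
    and cov: "covers P x" and nd: "needed P bs x i" and i: "i \<in> items P" "a i < x i"
  shows "\<exists>t\<in>{1..len P}. t \<in> ival P i \<and>
    (\<Sum>i'\<in>{i' \<in> items P. t \<in> ival P i'} - {i}. x i' - a i') \<le> resid P a t"
proof -
  obtain ds j rs where n: "bs = ds @ (i, j, {j..x i}) # rs"
    "\<not> covers P ((\<lambda>i'. max (x i') (blev rs i'))(i := j - 1))"
    using nd by (auto simp: needed_def)
  have wfo: "wf_blocks old" using wf unfolding bs by (rule wf_blocks_append)
  have wfc: "wf_blocks ((i, j, {j..x i}) # rs)" using wf unfolding n(1) by (rule wf_blocks_append)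
  then obtain q where "j \<le> q" "{j..x i} = {j..q}" and j1: "j = blev rs i + 1" by auto
  then have "j \<le> x i" by (simp add: Icc_eq_Icc)
  note j = j1 this
  have notold: "(i, j, {j..x i}) \<notin> set old"
  proof
    assume "(i, j, {j..x i}) \<in> set old"
    then have "x i \<in> ends old i" using j(2) by (auto simp: ends_def)
    from ends_le_blev[OF wfo this] show False using a[OF i(1)] i(2) by simp
  qed
  \<comment> \<open>The block of \<open>i\<close> is not in \<open>old\<close>, so the split at this
    block falls inside \<open>new\<close>.\<close>
  obtain w where w: "rs = w @ old"
  proof -
    have "ds @ (i, j, {j..x i}) # rs = new @ old" using bs n(1) by simp
    then consider us where "ds @ us = new" "(i, j, {j..x i}) # rs = us @ old"
      | us where "ds = new @ us" "us @ (i, j, {j..x i}) # rs = old"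
      unfolding append_eq_append_conv2 by auto
    then show ?thesis
    proof cases
      case 1
      then show ?thesis using notold that by (cases us) auto
    next
      case 2
      then show ?thesis using notold by auto
    qed
  qed
  have ge: "a i' \<le> blev rs i'" if "i' \<in> items P" for i'
    using a[OF that] by (simp add: w blev_append)
  let ?y = "(\<lambda>i'. max (x i') (a i'))(i := a i)"
  have "\<not> covers P ?y"
  proof (rule not_covers_mono[OF n(2)])
    fix i' assume "i' \<in> items P"
    from ge[OF this] show "?y i' \<le> ((\<lambda>i'. max (x i') (blev rs i'))(i := j - 1)) i'"
      using j(1) by (cases "i' = i") auto
  qed
  then obtain t where t: "t \<in> {1..len P}" and
    lt: "(\<Sum>i'\<in>{i' \<in> items P. t \<in> ival P i'}. ?y i') < dem P t" by (auto simp: covers_def not_le)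
  let ?S = "{i' \<in> items P. t \<in> ival P i'}"
  have covt: "dem P t \<le> (\<Sum>i'\<in>?S. x i')" using cov t by (simp add: covers_def)
  \<comment> \<open>Lowering \<open>i\<close> affects only times in its interval; elsewhere
    \<open>?y\<close> dominates the covering vector \<open>x\<close>.\<close>
  have ti: "t \<in> ival P i"
  proof (rule ccontr)
    assume "t \<notin> ival P i"
    then have "(\<Sum>i'\<in>?S. x i') \<le> (\<Sum>i'\<in>?S. ?y i')" by (intro sum_mono) auto
    then show False using covt lt by simp
  qed
  have iS: "i \<in> ?S" and finS: "finite ?S" using i(1) ti fin by auto
  have "(\<Sum>i'\<in>?S. ?y i') = ?y i + (\<Sum>i'\<in>?S - {i}. ?y i')" by (rule sum.remove[OF finS iS])
  \<comment> \<open>With truncated subtraction, \<open>max (x i') (a i')\<close> is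
    \<open>(x i' - a i') + a i'\<close>.\<close>
  also have "(\<Sum>i'\<in>?S - {i}. ?y i') = (\<Sum>i'\<in>?S - {i}. (x i' - a i') + a i')"
    by (intro sum.cong) auto
  also have "\<dots> = (\<Sum>i'\<in>?S - {i}. x i' - a i') + (\<Sum>i'\<in>?S - {i}. a i')" by (rule sum.distrib)
  finally have "(\<Sum>i'\<in>?S. ?y i') = (\<Sum>i'\<in>?S - {i}. x i' - a i') + (a i + (\<Sum>i'\<in>?S - {i}. a i'))"
    by simp
  also have "a i + (\<Sum>i'\<in>?S - {i}. a i') = (\<Sum>i'\<in>?S. a i')"
    by (rule sum.remove[OF finS iS, symmetric])
  finally have "(\<Sum>i'\<in>?S - {i}. x i' - a i') \<le> resid P a t" using lt by (simp add: resid_def)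
  then show ?thesis using t ti by blast
qed

text \<open>Item \<open>i\<close> contributes at most \<open>D\<close> by truncation; all other
  members of \<open>A\<close> contain \<open>p\<close>, so the last assumption bounds them together
  by \<open>D\<close>.\<close>

lemma sum_le_twice_if_common_point:
  fixes u :: "'a \<Rightarrow> nat"
  assumes "finite N" "A \<subseteq> N" "i \<in> A" "\<And>i'. i' \<in> A \<Longrightarrow> p \<in> I i'"
    and "(\<Sum>i'\<in>{i' \<in> N. p \<in> I i'} - {i}. u i') \<le> D"
  shows "(\<Sum>i\<in>A. min (u i) D) \<le> 2 * D"
proof -
  have finA: "finite A" by (rule finite_subset[OF assms(2,1)])
  have "(\<Sum>i'\<in>A. min (u i') D) = min (u i) D + (\<Sum>i'\<in>A - {i}. min (u i') D)"
    by (rule sum.remove[OF finA assms(3)])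
  moreover have "(\<Sum>i'\<in>A - {i}. min (u i') D) \<le> (\<Sum>i'\<in>A - {i}. u i')" by (intro sum_mono) auto
  moreover have "(\<Sum>i'\<in>A - {i}. u i') \<le> (\<Sum>i'\<in>{i' \<in> N. p \<in> I i'} - {i}. u i')"
    using assms(1,2,4) by (intro sum_mono2) auto
  ultimately show ?thesis using assms(5) by simp
qed

lemma sum_le_four_times:
  fixes u :: "'a \<Rightarrow> nat" and I :: "'a \<Rightarrow> nat set"
  assumes fin: "finite N" and S: "S \<subseteq> N"
    and ival: "\<And>i. i \<in> S \<Longrightarrow> \<exists>l r. I i = {l..r}" and t: "\<And>i. i \<in> S \<Longrightarrow> t \<in> I i"
    and p: "\<And>i. i \<in> S \<Longrightarrow> p i \<in> I i"
    and le: "\<And>i. i \<in> S \<Longrightarrow> (\<Sum>i'\<in>{i' \<in> N. p i \<in> I i'} - {i}. u i') \<le> D"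
  shows "(\<Sum>i\<in>S. min (u i) D) \<le> 4 * D"
proof -
  have between: "x \<in> I i" if "i \<in> S" "y \<in> I i" "z \<in> I i" "y \<le> x" "x \<le> z" for i x y z
  proof -
    from ival[OF that(1)] obtain l r where "I i = {l..r}" by blast
    then show ?thesis using that(2-5) by simp
  qed
  have finS: "finite S" by (rule finite_subset[OF S fin])
  let ?L = "{i \<in> S. p i \<le> t}" and ?R = "{i \<in> S. t < p i}"
  have L: "(\<Sum>i\<in>?L. min (u i) D) \<le> 2 * D"
  proof (cases "?L = {}")
    case False
    then have "Max (p ` ?L) \<in> p ` ?L" using finS by (intro Max_in) auto
    then obtain i where i: "i \<in> ?L" "p i = Max (p ` ?L)" by auto
    have "p i' \<le> p i" if "i' \<in> ?L" for i' unfolding i(2) using finS that by (intro Max_ge) auto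
    \<comment> \<open>The point \<open>p i\<close> lies between \<open>p i'\<close> and
      \<open>t\<close>, both of which belong to the interval \<open>I i'\<close>.\<close>
    then have common: "p i \<in> I i'" if "i' \<in> ?L" for i'
      using between[of i' "p i'" t "p i"] that i(1) p[of i'] t[of i'] by simp
    show ?thesis
    proof (rule sum_le_twice_if_common_point[OF fin _ i(1) common])
      show "?L \<subseteq> N" using S by blast
      show "(\<Sum>i'\<in>{i' \<in> N. p i \<in> I i'} - {i}. u i') \<le> D" by (rule le) (use i(1) in simp)
    qed
  qed (simp only: sum.empty)
  have R: "(\<Sum>i\<in>?R. min (u i) D) \<le> 2 * D"
  proof (cases "?R = {}")
    case False
    then have "Min (p ` ?R) \<in> p ` ?R" using finS by (intro Min_in) auto
    then obtain i where i: "i \<in> ?R" "p i = Min (p ` ?R)" by auto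
    have "p i \<le> p i'" if "i' \<in> ?R" for i' unfolding i(2) using finS that by (intro Min_le) auto
    then have common: "p i \<in> I i'" if "i' \<in> ?R" for i'
      using between[of i' t "p i'" "p i"] that i(1) p[of i'] t[of i'] by simp
    show ?thesis
    proof (rule sum_le_twice_if_common_point[OF fin _ i(1) common])
      show "?R \<subseteq> N" using S by blast
      show "(\<Sum>i'\<in>{i' \<in> N. p i \<in> I i'} - {i}. u i') \<le> D" by (rule le) (use i(1) in simp)
    qed
  qed (simp only: sum.empty)
  have "(\<Sum>i\<in>S. min (u i) D) = (\<Sum>i\<in>?L \<union> ?R. min (u i) D)" by (intro sum.cong) auto
  also have "\<dots> = (\<Sum>i\<in>?L. min (u i) D) + (\<Sum>i\<in>?R. min (u i) D)"
    using finS by (intro sum.union_disjoint) auto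
  finally show ?thesis using L R by simp
qed

lemma weight_le_four_resid:
  assumes inst: "ufp_instance P" and inv: "grow_inv P s" and h: "hist P s (t, a, F)"
    and x: "pruned P (blocks s) [] x"
  shows "weight P x (t, a, F) \<le> 4 * resid P a t"
proof -
  have fin: "finite (items P)" using inst by (simp add: ufp_instance_def)
  let ?T = "{i \<in> items P. t \<in> ival P i}" and ?D = "resid P a t"
  let ?S = "{i \<in> ?T. a i < x i}"
  have g: "grouped P a F" and t: "t \<in> {1..len P}" and tmax: "\<And>t'. t' \<in> {1..len P} \<Longrightarrow> resid P a t' \<le> ?D"
    and e: "\<And>i q. i \<in> items P \<Longrightarrow> q \<in> ends (blocks s) i \<Longrightarrow> a i < q \<Longrightarrow> q < mx P \<Longrightarrow> Suc q \<in> roots P F i"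
    using h by (auto simp: hist_def)
  obtain new old where bs: "blocks s = new @ old" and old: "\<And>i. i \<in> items P \<Longrightarrow> blev old i = a i"
    using h by (auto simp: hist_def)
  have xe: "x i \<in> ends (blocks s) i" if "i \<in> items P" for i using x that by (simp add: pruned_def)
  have xm: "x i \<le> mx P" if "i \<in> items P" for i
    using ends_le_blev[OF grow_invD(4)[OF inv] xe[OF that]] grow_invD(6)[OF inv that]
      groupedD(2)[OF grow_invD(1)[OF inv] that] by simp
  have "weight P x (t, a, F) \<le> (\<Sum>i\<in>?T. min (x i - a i) ?D)"
    unfolding weight_def split
  proof (rule sum_mono)
    fix i assume "i \<in> ?T"
    then have i: "i \<in> items P" by simp
    show "(\<Sum>j\<in>{a i + 1..x i}. tau P i j a F t) \<le> min (x i - a i) ?D"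
      \<comment> \<open>The level \<open>x i\<close> is a block end, so if it lies above
        \<open>a i\<close> and below \<open>mx P\<close>, the history of the triple makes its
        successor a root of \<open>F\<close>.\<close>
      by (rule tau_sum_le[OF g i xm[OF i] e[OF i xe[OF i]]])
  qed
  also have "\<dots> = (\<Sum>i\<in>?S. min (x i - a i) ?D)"
    by (rule sum.mono_neutral_right) (use fin in auto)
  also have "\<dots> \<le> 4 * ?D"
  proof -
    have "\<exists>p. p \<in> ival P i \<and> (\<Sum>i'\<in>{i' \<in> items P. p \<in> ival P i'} - {i}. x i' - a i') \<le> ?D"
      if i: "i \<in> ?S" for i
    proof -
      \<comment> \<open>With nothing left to examine, \<open>pruned\<close> gives
        \<open>needed\<close> for every positive level, and \<open>x i\<close> exceeds
        \<open>a i\<close>.\<close>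
      have "needed P (blocks s) x i" "covers P x" using x i by (auto simp: pruned_def)
      then obtain p where "p \<in> {1..len P}" "p \<in> ival P i"
        "(\<Sum>i'\<in>{i' \<in> items P. p \<in> ival P i'} - {i}. x i' - a i') \<le> resid P a p"
        using needed_witness[OF fin grow_invD(4)[OF inv] bs old, of x i] i by auto
      \<comment> \<open>The time \<open>t\<close> had maximal residual demand when its variable was
        raised.\<close>
      then show ?thesis using tmax order_trans by blast
    qed
    then have "\<forall>i\<in>?S. \<exists>p. p \<in> ival P i \<and>
        (\<Sum>i'\<in>{i' \<in> items P. p \<in> ival P i'} - {i}. x i' - a i') \<le> ?D" by blast
    from bchoice[OF this] obtain p where p: "\<And>i. i \<in> ?S \<Longrightarrow> p i \<in> ival P i"
        "\<And>i. i \<in> ?S \<Longrightarrow> (\<Sum>i'\<in>{i' \<in> items P. p i \<in> ival P i'} - {i}. x i' - a i') \<le> ?D" by blast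
    show ?thesis
    proof (rule sum_le_four_times[OF fin _ _ _ p])
      show "\<exists>l r. ival P i = {l..r}" if "i \<in> ?S" for i
        using inst that by (auto simp: ufp_instance_def)
    qed auto
  qed
  finally show ?thesis .
qed

section \<open>Comparison with a solution of finite cost\<close>

lemma finite_feasible:
  assumes "finite (items P)"
  shows "finite (feasible P)"
proof (rule finite_subset)
  show "feasible P \<subseteq> items P \<rightarrow>\<^sub>E {0..mx P}" by (auto simp: feasible_def)
  show "finite (items P \<rightarrow>\<^sub>E {0..mx P})" using assms by (intro finite_PiE) auto
qed

lemma output_approx:
  assumes inst: "ufp_instance P" and y: "y \<in> feasible P" "cost P y < \<infinity>"
    and inv: "grow_inv P s" and fin: "finished P s"
  defines "x \<equiv> sol P (prune P (blocks s))"
  shows "x \<in> feasible P \<and> cost P x \<le> 4 * cost P y"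
proof -
  have finN: "finite (items P)" using inst by (simp add: ufp_instance_def)
  let ?v = "dual s"
  have "covers P (lev s)" using fin by (auto simp: finished_def covers_def resid_def)
  then have "covers P (blev (blocks s))"
    using covers_cong[of P "lev s" "blev (blocks s)"] grow_invD(6)[OF inv] by blast
  then have pr: "pruned P (blocks s) [] x"
    unfolding x_def by (intro prune_pruned[OF grow_invD(4)[OF inv] grow_invD(5)[OF inv]])
  have xl: "x i \<le> lev s i" if "i \<in> items P" for i
    using ends_le_blev[OF grow_invD(4)[OF inv], of "x i" i] pr that grow_invD(6)[OF inv that]
    by (simp add: pruned_def)
  note g = grow_invD(1)[OF inv]
  have xm: "x i \<le> mx P" if "i \<in> items P" for i
    using xl[OF that] groupedD(2)[OF g that] by simp
  have "x \<in> items P \<rightarrow>\<^sub>E {0..mx P}"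
  proof (rule PiE_I)
    show "x i = undefined" if "i \<notin> items P" for i using that by (simp add: x_def sol_def)
  qed (use xm in simp)
  then have feas: "x \<in> feasible P" using pr by (simp add: feasible_def pruned_def)
  have ym: "y i \<le> mx P" if "i \<in> items P" for i
    using y(1) that by (auto simp: feasible_def dest: PiE_mem)
  have yfin: "fcost P i (y i) \<noteq> \<infinity>" if "i \<in> items P" for i
    by (rule fcost_finite_if_cost_finite[OF inst y(2) that])
  have f0fin: "fcost P i 0 \<noteq> \<infinity>" if "i \<in> items P" for i
    using fcost_mono[OF inst that le0 ym[OF that]] yfin[OF that] by auto
  have "\<exists>c. 0 \<le> c \<and> fcost P i 0 = ereal c" if "i \<in> items P" for i
    using fcost_real[OF inst that le0 f0fin[OF that]] by blast
  then obtain c where c: "\<And>i. i \<in> items P \<Longrightarrow> 0 \<le> c i \<and> fcost P i 0 = ereal (c i)" by metis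
  \<comment> \<open>The costs at level 0 are not seen by the dual; both solutions pay them, and they
    are split off. The dual objective value is \<open>dv\<close>.\<close>
  define base where "base = (\<Sum>i\<in>items P. c i)"
  define dv where "dv = (\<Sum>(t, a, F)\<in>Hset P. real (resid P a t) * ?v (t, a, F))"
  have base0: "0 \<le> base" unfolding base_def using c by (intro sum_nonneg) auto
  have vpos: "0 \<le> ?v h" if "h \<in> Hset P" for h
    using grow_invD(2)[OF inv] that by (simp add: dual_feasible_def)
  \<comment> \<open>Output levels do not exceed \<open>lev s i\<close>, and no root lies at or below
    that level.\<close>
  have full: "full P ?v i j" if "i \<in> items P" "j \<in> {1..x i}" for i j
  proof (rule grow_invD(3)[OF inv that(1)])
    show "j \<in> {1..mx P}" using that xm[OF that(1)] by simp
    have "j \<le> lev s i" using that xl[OF that(1)] by simp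
    then show "j \<notin> roots P (cls s) i" using groupedD(1)[OF g that(1)] by (auto simp: groups_def)
  qed
  have "cost P x = (\<Sum>i\<in>items P. ereal (c i + (\<Sum>j\<in>{1..x i}. dual_lhs P ?v i j)))"
    unfolding cost_def
  proof (rule sum.cong[OF refl])
    fix i assume i: "i \<in> items P"
    show "fcost P i (x i) = ereal (c i + (\<Sum>j\<in>{1..x i}. dual_lhs P ?v i j))"
      using fcost_eq_dual_lhs[OF inst i f0fin[OF i] xm[OF i] full[OF i]] c[OF i] by simp
  qed
  also have "\<dots> = ereal (base + (\<Sum>h\<in>Hset P. real (weight P x h) * ?v h))"
    unfolding sum_ereal sum.distrib base_def sum_dual_lhs_eq_weight[OF finN] ..
  finally have cx: "cost P x = ereal (base + (\<Sum>h\<in>Hset P. real (weight P x h) * ?v h))" .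
  have "(\<Sum>h\<in>Hset P. real (weight P x h) * ?v h) \<le>
      (\<Sum>(t, a, F)\<in>Hset P. 4 * (real (resid P a t) * ?v (t, a, F)))"
  proof (rule sum_mono)
    fix h assume hH: "h \<in> Hset P"
    obtain t a F where h: "h = (t, a, F)" by (cases h)
    have "real (weight P x h) * ?v h \<le> real (4 * resid P a t) * ?v h"
    proof (cases "?v h = 0")
      case False
      then have "weight P x h \<le> 4 * resid P a t"
        using weight_le_four_resid[OF inst inv _ pr] grow_invD(7)[OF inv False] h by simp
      then have "real (weight P x h) \<le> real (4 * resid P a t)" by (simp only: of_nat_le_iff)
      then show ?thesis by (rule mult_right_mono[OF _ vpos[OF hH]])
    qed simp
    then show "real (weight P x h) * ?v h \<le> (case h of (t, a, F) \<Rightarrow> 4 * (real (resid P a t) * ?v (t, a, F)))"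
      by (simp add: h)
  qed
  also have "\<dots> = 4 * dv"
    unfolding dv_def sum_distrib_left by (intro sum.cong) auto
  finally have upper: "(\<Sum>h\<in>Hset P. real (weight P x h) * ?v h) \<le> 4 * dv" .
  have "dv \<le> (\<Sum>h\<in>Hset P. real (weight P y h) * ?v h)"
    unfolding dv_def
  proof (rule sum_mono)
    fix h assume hH: "h \<in> Hset P"
    obtain t a F where h: "h = (t, a, F)" by (cases h)
    have "real (resid P a t) * ?v h \<le> real (weight P y h) * ?v h"
    proof (cases "?v h = 0")
      case False
      then have "grouped P a F" "t \<in> {1..len P}"
        using grow_invD(7)[OF inv False] h by (auto simp: hist_def)
      then have "real (resid P a t) \<le> real (weight P y h)"
        using weight_ge_resid[OF finN _ _ y(1)] h by simp
      then show ?thesis by (rule mult_right_mono[OF _ vpos[OF hH]])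
    qed simp
    then show "(case h of (t, a, F) \<Rightarrow> real (resid P a t) * ?v (t, a, F)) \<le> real (weight P y h) * ?v h"
      by (simp add: h)
  qed
  moreover have "ereal (base + (\<Sum>h\<in>Hset P. real (weight P y h) * ?v h)) \<le> cost P y"
  proof -
    have "ereal (base + (\<Sum>h\<in>Hset P. real (weight P y h) * ?v h)) =
        (\<Sum>i\<in>items P. ereal (c i + (\<Sum>j\<in>{1..y i}. dual_lhs P ?v i j)))"
      unfolding sum_ereal sum.distrib base_def sum_dual_lhs_eq_weight[OF finN] ..
    also have "\<dots> \<le> cost P y"
      unfolding cost_def
    proof (rule sum_mono)
      fix i assume i: "i \<in> items P"
      show "ereal (c i + (\<Sum>j\<in>{1..y i}. dual_lhs P ?v i j)) \<le> fcost P i (y i)"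
        using fcost_ge_dual_lhs[OF inst grow_invD(2)[OF inv] i ym[OF i] yfin[OF i]] c[OF i] by simp
    qed
    finally show ?thesis .
  qed
  ultimately have lower: "ereal (base + dv) \<le> cost P y"
    by (meson add_left_mono ereal_less_eq(3) order_trans)
  \<comment> \<open>The factor 4 is lost only on the dual part; nonnegativity of \<open>base\<close>
    lets it be applied to the whole sum.\<close>
  have "cost P x \<le> ereal (4 * (base + dv))" using cx upper base0 by simp
  also have "\<dots> = 4 * ereal (base + dv)" by (simp add: numeral_eq_ereal)
  also have "\<dots> \<le> 4 * cost P y" using lower by (intro ereal_mult_left_mono) auto
  finally show ?thesis using feas by blast
qed

text \<open>The bound on the length of runs and the absence of stuck states together give
  termination, so the third conjunct speaks about an existing output. The solution of finite cost
  guarantees that every raise meets a constraint with finite right-hand side.\<close>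

theorem theorem3:
  fixes P :: "'a ufp"
  assumes "ufp_instance P"
    and "\<exists>x\<in>feasible P. cost P x < \<infinity>"
  shows "(\<forall>n s. (grow P ^^ n) (init P) s \<longrightarrow> n \<le> card (items P) * mx P) \<and>
         (\<forall>s. (grow P)\<^sup>*\<^sup>* (init P) s \<and> \<not> finished P s \<longrightarrow> (\<exists>s'. grow P s s')) \<and>
         (\<forall>x. alg3_output P x \<longrightarrow> x \<in> feasible P \<and> cost P x \<le> 4 * opt P)"
proof (intro conjI allI impI)
  obtain x0 where x0: "x0 \<in> feasible P" "cost P x0 < \<infinity>" using assms(2) by blast
  have inv: "grow_inv P s" if "(grow P)\<^sup>*\<^sup>* (init P) s" for s
    using grow_steps[OF assms(1)] rtranclp_imp_relpowp[OF that] by blast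
  show "n \<le> card (items P) * mx P" if "(grow P ^^ n) (init P) s" for n s
    using grow_steps[OF assms(1) that] by simp
  show "\<exists>s'. grow P s s'" if "(grow P)\<^sup>*\<^sup>* (init P) s \<and> \<not> finished P s" for s
    using grow_progress[OF assms(1) x0 inv] that by blast
  have finF: "finite (cost P ` feasible P)"
    using finite_feasible[of P] assms(1) by (simp add: ufp_instance_def)
  \<comment> \<open>The minimum is attained because the feasible set is finite, so an optimal
    solution serves as the competitor.\<close>
  then have "opt P \<in> cost P ` feasible P" unfolding opt_def using x0 by (intro Min_in) auto
  then obtain y where y: "y \<in> feasible P" "opt P = cost P y" by auto
  have "opt P \<le> cost P x0" unfolding opt_def using finF x0 by (intro Min_le) auto
  then have yfin: "cost P y < \<infinity>" unfolding y(2) by (rule le_less_trans[OF _ x0(2)])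
  fix x assume "alg3_output P x"
  then obtain s where s: "(grow P)\<^sup>*\<^sup>* (init P) s" "finished P s" "x = sol P (prune P (blocks s))"
    by (auto simp: alg3_output_def)
  have "x \<in> feasible P \<and> cost P x \<le> 4 * opt P"
    using output_approx[OF assms(1) y(1) yfin inv[OF s(1)] s(2)] s(3) y(2) by simp
  then show "x \<in> feasible P" "cost P x \<le> 4 * opt P" by blast+
qed

end
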